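(* Let $\alpha>0$, $\delta>0$, $T_0\in\mathbb{R}$, $T>0$, and let $\mathcal{S}$ be a set of complex numbers $s=\sigma+\mathrm{i}t$ satisfying $\sigma\ge\alpha$ and $T_0+\delta/2\le t\le T_0+T-\delta/2$, such that $|\Im s-\Im s'|\ge\delta$ for all distinct $s,s'\in\mathcal{S}$. Let $N\ge2$ and let $N\le n_1\le\dots\le n_J\le 2N$ be real numbers, $a_1,\dots,a_J$ complex numbers, and $S(s)=\sum_{j=1}^{J}a_j n_j^{-s}$. Then for every $\eta>0$, \[ \sum_{s\in\mathcal{S}}|S(s)|^{2}\ll\Bigl(T+\frac{1}{\eta}\Bigr)\Bigl(\log N+\frac{1}{\delta}\Bigr)\sum_{j=1}^{J}\chi(n_j,\eta N)\frac{|a_j|^2}{N^{2\alpha}}, \] with an absolute implied constant.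
   Context: For $x\in\mathbb{R}$ and $\lambda>0$, $\chi(x,\lambda)=\#\{j\in\{1,\dots,J\}: |x-n_j|\le\lambda\}$ is the number of the $n_j$ within distance $\lambda$ of $x$. *)

theory Defs
  imports "HOL-Analysis.Analysis"
begin

text \<open>The points are indexed by \<open>j = 1, \<dots>, J\<close>; values of \<open>n\<close> and \<open>a\<close> outside this range play no role.
  Indices are counted, so coinciding points contribute with multiplicity.\<close>

definition chi :: "nat \<Rightarrow> (nat \<Rightarrow> real) \<Rightarrow> real \<Rightarrow> real \<Rightarrow> nat" where
  "chi J n x lam = card {j \<in> {1..J}. \<bar>x - n j\<bar> \<le> lam}"

definition dirichlet_poly :: "nat \<Rightarrow> (nat \<Rightarrow> real) \<Rightarrow> (nat \<Rightarrow> complex) \<Rightarrow> complex \<Rightarrow> complex" where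
  "dirichlet_poly J n a s = (\<Sum>j = 1..J. a j * complex_of_real (n j) powr (- s))"

text \<open>A set of complex numbers that is \<open>\<delta>\<close>-separated in its imaginary parts, and whose imaginary
  parts lie in a bounded interval, is finite; hence no finiteness condition is included here, and
  sums over such a set are genuine finite sums.\<close>

definition admissible :: "real \<Rightarrow> real \<Rightarrow> real \<Rightarrow> real \<Rightarrow> complex set \<Rightarrow> bool" where
  "admissible \<alpha> \<delta> T0 T SS \<longleftrightarrow>
     (\<forall>s\<in>SS. Re s \<ge> \<alpha> \<and> T0 + \<delta> / 2 \<le> Im s \<and> Im s \<le> T0 + T - \<delta> / 2) \<and>
     (\<forall>s\<in>SS. \<forall>s'\<in>SS. s \<noteq> s' \<longrightarrow> \<bar>Im s - Im s'\<bar> \<ge> \<delta>)"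

end

theory Submission
  imports Defs
begin

text \<open>Put \<open>y\<^sub>j = ln (n\<^sub>j / N) \<in> [0, ln 2]\<close>. By duality the claim is a bound for
  \<open>\<Sum>\<^sub>j |G(y\<^sub>j)|\<^sup>2 / \<chi>(n\<^sub>j, \<eta> N)\<close> with \<open>G(y) = \<Sum>\<^sub>r c\<^sub>r exp (- z\<^sub>r y)\<close> and \<open>z\<^sub>r = s\<^sub>r + 1 - i T0\<close>; the shift
  by \<open>1\<close> costs only a constant since \<open>y\<^sub>j\<close> is bounded. The weights \<open>1 / \<chi>\<close> have total mass at most \<open>1\<close>
  on every window of length \<open>\<eta> / 2\<close>, so a Sobolev argument as in Gallagher's inequality reduces this to
  \<open>L\<^sup>2\<close> bounds for \<open>G\<close> and \<open>G'\<close>. The real parts of the \<open>z\<^sub>r\<close> may vary freely, which makes the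
  \<open>L\<^sup>2\<close> bound a Carleson embedding; it amounts to the boundedness of a quadratic form in Poisson
  kernels \<open>\<sigma> / (\<sigma>\<^sup>2 + t\<^sup>2)\<close>. The points with \<open>\<sigma> \<ge> 1 / \<eta>\<close>, and the case \<open>\<eta> \<ge> 1\<close>, follow from
  Cauchy-Schwarz for each \<open>s\<close>, because there are at most \<open>T / \<delta>\<close> points.\<close>

section \<open>Poisson kernels and their sums over separated points\<close>

text \<open>The Poisson kernel of the half-plane without the factor 1/pi; for \<sigma> > 0 it is the
  real part of 1 / (\<sigma> + i t).\<close>

definition poisson :: "real \<Rightarrow> real \<Rightarrow> real" where
  "poisson \<sigma> t = \<sigma> / (\<sigma>\<^sup>2 + t\<^sup>2)"

lemma poisson_nonneg: "\<sigma> \<ge> 0 \<Longrightarrow> poisson \<sigma> t \<ge> 0"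
  by (simp add: poisson_def)

lemma poisson_minus_commute: "poisson \<sigma> (t - u) = poisson \<sigma> (u - t)"
  by (simp add: poisson_def power2_commute)

lemma poisson_antimono:
  assumes "\<sigma> > 0" "\<bar>t\<bar> \<le> \<bar>u\<bar>"
  shows "poisson \<sigma> u \<le> poisson \<sigma> t"
proof -
  have "t\<^sup>2 \<le> u\<^sup>2" using assms(2) by (simp add: abs_le_square_iff)
  then show ?thesis unfolding poisson_def using assms(1)
    by (intro divide_left_mono mult_pos_pos add_pos_nonneg) auto
qed

lemma poisson_half_le:
  assumes "\<sigma> > 0"
  shows "poisson \<sigma> (t / 2) \<le> 4 * poisson \<sigma> t"
proof -
  have "\<sigma> * (\<sigma>\<^sup>2 + t\<^sup>2) \<le> 4 * \<sigma> * (\<sigma>\<^sup>2 + (t/2)\<^sup>2)"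
    using assms by (simp add: algebra_simps power2_eq_square)
  moreover have "\<sigma>\<^sup>2 + t\<^sup>2 > 0" "\<sigma>\<^sup>2 + (t/2)\<^sup>2 > 0"
    using assms by (auto intro: add_pos_nonneg)
  ultimately show ?thesis
    unfolding poisson_def by (simp add: divide_simps algebra_simps)
qed

text \<open>The kernel is a rescaled derivative of arctan. That derivative decreases on the positive
  axis, so its value at the right end of a cell is at most the mean over the cell. The right-hand
  side telescopes when summed over k.\<close>

lemma poisson_le_arctan_diff:
  assumes "\<sigma> > 0" "\<delta> > 0"
  shows "poisson \<sigma> (real (Suc k) * \<delta>)
    \<le> (arctan (real (Suc k) * \<delta> / \<sigma>) - arctan (real k * \<delta> / \<sigma>)) / \<delta>"
proof -
  define a b where "a = real k * \<delta> / \<sigma>" and "b = real (Suc k) * \<delta> / \<sigma>"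
  have ab: "a < b" "0 \<le> a" "b - a = \<delta> / \<sigma>"
    using assms by (auto simp: a_def b_def field_simps)
  obtain \<xi> where \<xi>: "a < \<xi>" "\<xi> < b" "arctan b - arctan a = (b - a) * inverse (1 + \<xi>\<^sup>2)"
    using MVT2[OF ab(1), of arctan "\<lambda>x. inverse (1 + x\<^sup>2)"] DERIV_arctan by blast
  have "\<xi>\<^sup>2 \<le> b\<^sup>2" using \<xi> ab by (intro power_mono) auto
  then have le: "inverse (1 + b\<^sup>2) \<le> inverse (1 + \<xi>\<^sup>2)"
    by (intro le_imp_inverse_le) (auto intro: add_pos_nonneg)
  have "poisson \<sigma> (real (Suc k) * \<delta>) = poisson \<sigma> (b * \<sigma>)"
    using assms by (simp add: b_def)
  also have "\<dots> = inverse (1 + b\<^sup>2) / \<sigma>"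
  proof -
    have "\<sigma>\<^sup>2 + (b * \<sigma>)\<^sup>2 = \<sigma> * (\<sigma> * (1 + b\<^sup>2))"
      by (simp add: algebra_simps power2_eq_square)
    then have "poisson \<sigma> (b * \<sigma>) = 1 / (\<sigma> * (1 + b\<^sup>2))"
      unfolding poisson_def using assms by simp
    then show ?thesis by (simp add: inverse_eq_divide mult.commute)
  qed
  also have "\<dots> \<le> inverse (1 + \<xi>\<^sup>2) / \<sigma>"
    using le assms by (simp add: divide_right_mono)
  also have "\<dots> = (arctan b - arctan a) / \<delta>"
    unfolding \<xi>(3) ab(3) using assms by simp
  finally show ?thesis by (simp add: a_def b_def)
qed

lemma sum_poisson_multiples_le:
  assumes "\<sigma> > 0" "\<delta> > 0"
  shows "(\<Sum>k\<le>m. poisson \<sigma> (real k * \<delta>)) \<le> 1 / \<sigma> + 2 / \<delta>"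
proof -
  \<comment> \<open>The term k = 0 equals 1 / \<sigma>; all later terms telescope.\<close>
  have "(\<Sum>k\<le>m. poisson \<sigma> (real k * \<delta>)) \<le> 1 / \<sigma> + arctan (real m * \<delta> / \<sigma>) / \<delta>"
  proof (induction m)
    case 0
    then show ?case using assms by (simp add: poisson_def power2_eq_square)
  next
    case (Suc m)
    then show ?case using poisson_le_arctan_diff[OF assms, of m]
      by (simp add: diff_divide_distrib)
  qed
  moreover have "arctan (real m * \<delta> / \<sigma>) \<le> 2"
    using arctan_ubound[of "real m * \<delta> / \<sigma>"] pi_less_4 by simp
  then have "arctan (real m * \<delta> / \<sigma>) / \<delta> \<le> 2 / \<delta>"
    using assms by (intro divide_right_mono) auto
  ultimately show ?thesis by linarith
qed

text \<open>Two values in the same half-open cell of length \<delta> differ by less than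
  \<delta>.\<close>

lemma inj_on_floor_divide:
  fixes u :: "'a \<Rightarrow> real"
  assumes "\<delta> > 0" and sep: "\<And>r s. r \<in> R \<Longrightarrow> s \<in> R \<Longrightarrow> r \<noteq> s \<Longrightarrow> \<bar>u r - u s\<bar> \<ge> \<delta>"
  shows "inj_on (\<lambda>r. \<lfloor>u r / \<delta>\<rfloor>) R"
proof (rule inj_onI, rule ccontr)
  fix r s assume rs: "r \<in> R" "s \<in> R" "\<lfloor>u r / \<delta>\<rfloor> = \<lfloor>u s / \<delta>\<rfloor>" "r \<noteq> s"
  then have "\<bar>u r / \<delta> - u s / \<delta>\<bar> < 1" by linarith
  then have "\<bar>u r - u s\<bar> < \<delta>"
    using assms(1) by (simp flip: diff_divide_distrib add: abs_divide)
  with sep[OF rs(1,2,4)] show False by simp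
qed

lemma inj_on_nat_floor_divide:
  fixes u :: "'a \<Rightarrow> real"
  assumes "\<delta> > 0" and sep: "\<And>r s. r \<in> R \<Longrightarrow> s \<in> R \<Longrightarrow> r \<noteq> s \<Longrightarrow> \<bar>u r - u s\<bar> \<ge> \<delta>"
    and "\<And>r. r \<in> R \<Longrightarrow> u r \<ge> 0"
  shows "inj_on (\<lambda>r. nat \<lfloor>u r / \<delta>\<rfloor>) R"
proof (rule inj_onI)
  fix r s assume rs: "r \<in> R" "s \<in> R" "nat \<lfloor>u r / \<delta>\<rfloor> = nat \<lfloor>u s / \<delta>\<rfloor>"
  have "\<lfloor>u r / \<delta>\<rfloor> \<ge> 0" "\<lfloor>u s / \<delta>\<rfloor> \<ge> 0" using assms(1,3) rs by auto
  with rs(3) have "\<lfloor>u r / \<delta>\<rfloor> = \<lfloor>u s / \<delta>\<rfloor>" by linarith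
  moreover have "inj_on (\<lambda>r. \<lfloor>u r / \<delta>\<rfloor>) R" by (rule inj_on_floor_divide[OF assms(1) sep])
  ultimately show "r = s" using rs(1,2) by (auto dest: inj_onD)
qed

text \<open>Rounding each point down to a multiple of \<delta> moves it towards 0, which only
  increases the kernel. Separation makes the rounding injective, so the sum over multiples of
  \<delta> dominates.\<close>

lemma sum_poisson_separated_nonneg:
  fixes u :: "'a \<Rightarrow> real"
  assumes "finite R" "\<sigma> > 0" "\<delta> > 0"
    and sep: "\<And>r s. r \<in> R \<Longrightarrow> s \<in> R \<Longrightarrow> r \<noteq> s \<Longrightarrow> \<bar>u r - u s\<bar> \<ge> \<delta>"
    and pos: "\<And>r. r \<in> R \<Longrightarrow> u r \<ge> 0"
  shows "(\<Sum>r\<in>R. poisson \<sigma> (u r)) \<le> 1 / \<sigma> + 2 / \<delta>"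
proof -
  define k where "k r = nat \<lfloor>u r / \<delta>\<rfloor>" for r
  have inj: "inj_on k R"
    unfolding k_def by (rule inj_on_nat_floor_divide[OF assms(3) sep pos])
  have "poisson \<sigma> (u r) \<le> poisson \<sigma> (real (k r) * \<delta>)" if "r \<in> R" for r
  proof (rule poisson_antimono)
    have "u r / \<delta> \<ge> 0" using pos[OF that] assms(3) by simp
    then have "real (k r) \<le> u r / \<delta>" unfolding k_def by linarith
    then have "real (k r) * \<delta> \<le> u r" using assms(3) by (simp add: field_simps)
    then show "\<bar>real (k r) * \<delta>\<bar> \<le> \<bar>u r\<bar>" using assms(3) by simp
  qed (use assms in auto)
  then have "(\<Sum>r\<in>R. poisson \<sigma> (u r)) \<le> (\<Sum>r\<in>R. poisson \<sigma> (real (k r) * \<delta>))"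
    by (rule sum_mono)
  also have "\<dots> = (\<Sum>m\<in>k ` R. poisson \<sigma> (real m * \<delta>))"
    by (simp add: sum.reindex[OF inj])
  also have "\<dots> \<le> (\<Sum>m\<le>Max (k ` R). poisson \<sigma> (real m * \<delta>))"
    using assms(1,2) by (intro sum_mono2) (auto intro!: poisson_nonneg)
  also have "\<dots> \<le> 1 / \<sigma> + 2 / \<delta>" by (rule sum_poisson_multiples_le[OF assms(2,3)])
  finally show ?thesis .
qed

text \<open>The points on either side of x are treated as a one-sided separated set. The assumption
  \<sigma> \<ge> 1 absorbs 1 / \<sigma> into the constant and makes the bound uniform in
  \<sigma>.\<close>

lemma sum_poisson_separated:
  fixes t :: "'a \<Rightarrow> real"
  assumes "finite R" "\<sigma> \<ge> 1" "\<delta> > 0"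
    and sep: "\<And>r s. r \<in> R \<Longrightarrow> s \<in> R \<Longrightarrow> r \<noteq> s \<Longrightarrow> \<bar>t r - t s\<bar> \<ge> \<delta>"
  shows "(\<Sum>r\<in>R. poisson \<sigma> (x - t r)) \<le> 4 * (1 + 1 / \<delta>)"
proof -
  define R1 R2 where "R1 = {r\<in>R. t r \<le> x}" and "R2 = {r\<in>R. \<not> t r \<le> x}"
  have "R = R1 \<union> R2" "R1 \<inter> R2 = {}" by (auto simp: R1_def R2_def)
  then have "(\<Sum>r\<in>R. poisson \<sigma> (x - t r))
    = (\<Sum>r\<in>R1. poisson \<sigma> (x - t r)) + (\<Sum>r\<in>R2. poisson \<sigma> (x - t r))"
    using assms(1) by (metis finite_Un sum.union_disjoint)
  also have "(\<Sum>r\<in>R2. poisson \<sigma> (x - t r)) = (\<Sum>r\<in>R2. poisson \<sigma> (t r - x))"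
    by (intro sum.cong refl poisson_minus_commute)
  also have "(\<Sum>r\<in>R1. poisson \<sigma> (x - t r)) \<le> 1 / \<sigma> + 2 / \<delta>"
  proof (rule sum_poisson_separated_nonneg)
    fix r s assume "r \<in> R1" "s \<in> R1" "r \<noteq> s"
    then show "\<delta> \<le> \<bar>(x - t r) - (x - t s)\<bar>" using sep[of r s] by (simp add: R1_def)
  qed (use assms in \<open>auto simp: R1_def\<close>)
  also have "(\<Sum>r\<in>R2. poisson \<sigma> (t r - x)) \<le> 1 / \<sigma> + 2 / \<delta>"
  proof (rule sum_poisson_separated_nonneg)
    fix r s assume "r \<in> R2" "s \<in> R2" "r \<noteq> s"
    then show "\<delta> \<le> \<bar>(t r - x) - (t s - x)\<bar>" using sep[of r s] by (simp add: R2_def)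
  qed (use assms in \<open>auto simp: R2_def\<close>)
  also have "1 / \<sigma> + 2 / \<delta> + (1 / \<sigma> + 2 / \<delta>) \<le> 4 * (1 + 1 / \<delta>)"
    using assms(2,3) by (simp add: field_simps)
  finally show ?thesis by simp
qed

section \<open>Quadratic forms in Poisson kernels\<close>

text \<open>A quasi-triangle inequality: v lies at distance at least |t - t'| / 2 from t or from t',
  so one of the two factors is at most 8 times the wider kernel at t - t'. Summing over v then gives
  the Gram bound needed for the quadratic form.\<close>

lemma poisson_mult_le:
  assumes "0 < \<sigma>'" "\<sigma>' \<le> \<sigma>"
  shows "poisson \<sigma> (t - v) * poisson \<sigma>' (t' - v)
    \<le> 8 * poisson \<sigma> (t - t') * (poisson \<sigma> (t - v) + poisson \<sigma>' (t' - v))"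
proof -
  define p p' q where "p = poisson \<sigma> (t - v)" and "p' = poisson \<sigma>' (t' - v)"
    and "q = poisson \<sigma> (t - t')"
  have \<sigma>: "\<sigma> > 0" using assms by simp
  have nn: "p \<ge> 0" "p' \<ge> 0" "q \<ge> 0" using assms by (auto simp: p_def p'_def q_def poisson_nonneg)
  have "p \<le> 8 * q \<or> p' \<le> 8 * q"
  proof (cases "\<bar>t - t'\<bar> \<le> 2 * \<bar>t - v\<bar>")
    case True
    then have "p \<le> poisson \<sigma> ((t - t') / 2)"
      unfolding p_def using \<sigma> by (intro poisson_antimono) auto
    also have "\<dots> \<le> 4 * q" unfolding q_def by (rule poisson_half_le[OF \<sigma>])
    finally show ?thesis using nn by simp
  next
    case far: False
    show ?thesis
    \<comment> \<open>Within distance \<sigma> the wider kernel at t - t' is at least half of its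
      maximum 1 / \<sigma>, which bounds p. Farther out the narrower kernel at t - t' is at most
      twice the wider one, since both denominators are then comparable to the squared
      distance.\<close>
    proof (cases "\<bar>t - t'\<bar> \<le> \<sigma>")
      case True
      then have "(t - t')\<^sup>2 \<le> \<sigma>\<^sup>2" using \<sigma> by (simp flip: abs_le_square_iff)
      then have "1 / \<sigma> \<le> 2 * q"
        unfolding q_def poisson_def using \<sigma>
        by (simp add: divide_simps add_pos_nonneg power2_eq_square)
      moreover have "p \<le> poisson \<sigma> 0" unfolding p_def using \<sigma> by (intro poisson_antimono) auto
      ultimately show ?thesis using nn \<sigma> by (simp add: poisson_def power2_eq_square)
    next
      case False
      have "\<bar>(t - t') / 2\<bar> \<le> \<bar>t' - v\<bar>" 
        using far abs_triangle_ineq4[of "t - v" "t' - v"] unfolding abs_divide by simp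
      then have "p' \<le> poisson \<sigma>' ((t - t') / 2)"
        unfolding p'_def using assms(1) by (intro poisson_antimono) auto
      also have "\<dots> \<le> 4 * poisson \<sigma>' (t - t')" by (rule poisson_half_le[OF assms(1)])
      also have "poisson \<sigma>' (t - t') \<le> 2 * q"
      proof -
        define d where "d = t - t'"
        have d: "\<sigma>\<^sup>2 \<le> d\<^sup>2" "d\<^sup>2 > 0" using False \<sigma>
          by (auto simp: d_def abs_le_square_iff[symmetric])
        have "poisson \<sigma>' d \<le> \<sigma> / d\<^sup>2"
          unfolding poisson_def using assms d by (intro frac_le) auto
        also have "\<dots> \<le> 2 * poisson \<sigma> d"
          using d \<sigma> by (simp add: poisson_def divide_simps add_pos_nonneg)
        finally show ?thesis by (simp add: q_def d_def)
      qed
      finally show ?thesis by simp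
    qed
  qed
  then show ?thesis
  proof
    assume "p \<le> 8 * q"
    then have "p * p' \<le> 8 * q * p'" using nn by (intro mult_right_mono) auto
    also have "\<dots> \<le> 8 * q * (p + p')" using nn by (intro mult_left_mono) auto
    finally show ?thesis by (simp add: p_def p'_def q_def)
  next
    assume "p' \<le> 8 * q"
    then have "p * p' \<le> p * (8 * q)" using nn by (intro mult_left_mono) auto
    also have "\<dots> \<le> (p + p') * (8 * q)" using nn by (intro mult_right_mono) auto
    finally show ?thesis by (simp add: p_def p'_def q_def mult_ac)
  qed
qed

text \<open>This linearises a maximal-function bound: with \<open>q = x\<^sup>T A x\<close>, Cauchy-Schwarz gives
  \<open>q\<^sup>2 \<le> |x|\<^sup>2 |A\<^sup>T x|\<^sup>2\<close>, and the hypothesis \<open>A A\<^sup>T \<le> D (A + A\<^sup>T)\<close> gives \<open>|A\<^sup>T x|\<^sup>2 \<le> 2 D q\<close>.\<close>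

lemma quadratic_form_le_of_gram_le:
  fixes A :: "'a \<Rightarrow> 'a \<Rightarrow> real"
  assumes "finite R" and D: "D \<ge> 0"
    and x: "\<And>r. r \<in> R \<Longrightarrow> x r \<ge> 0"
    and gram: "\<And>r s. r \<in> R \<Longrightarrow> s \<in> R \<Longrightarrow> (\<Sum>v\<in>R. A r v * A s v) \<le> D * (A r s + A s r)"
  shows "(\<Sum>r\<in>R. \<Sum>s\<in>R. x r * x s * A r s) \<le> 2 * D * (\<Sum>r\<in>R. (x r)\<^sup>2)"
proof -
  define q where "q = (\<Sum>r\<in>R. \<Sum>s\<in>R. x r * x s * A r s)"
  define y where "y v = (\<Sum>r\<in>R. x r * A r v)" for v
  have q': "q = (\<Sum>r\<in>R. \<Sum>s\<in>R. x r * x s * A s r)"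
    unfolding q_def by (subst sum.swap) (simp add: mult_ac)
  have "(\<Sum>v\<in>R. (y v)\<^sup>2) = (\<Sum>v\<in>R. \<Sum>r\<in>R. \<Sum>s\<in>R. x r * x s * (A r v * A s v))"
    by (simp add: y_def power2_eq_square sum_product mult_ac)
  also have "\<dots> = (\<Sum>r\<in>R. \<Sum>s\<in>R. \<Sum>v\<in>R. x r * x s * (A r v * A s v))"
    by (subst sum.swap, rule sum.cong[OF refl], subst sum.swap, rule refl)
  also have "\<dots> = (\<Sum>r\<in>R. \<Sum>s\<in>R. x r * x s * (\<Sum>v\<in>R. A r v * A s v))"
    by (simp add: sum_distrib_left)
  also have "\<dots> \<le> (\<Sum>r\<in>R. \<Sum>s\<in>R. x r * x s * (D * (A r s + A s r)))"
    by (intro sum_mono mult_left_mono gram mult_nonneg_nonneg x)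
  also have "\<dots> = D * (\<Sum>r\<in>R. \<Sum>s\<in>R. x r * x s * A r s) + D * (\<Sum>r\<in>R. \<Sum>s\<in>R. x r * x s * A s r)"
    by (simp add: sum_distrib_left algebra_simps flip: sum.distrib)
  also have "\<dots> = 2 * D * q" using q' q_def by simp
  finally have y2: "(\<Sum>v\<in>R. (y v)\<^sup>2) \<le> 2 * D * q" .
  have qy: "q = (\<Sum>v\<in>R. x v * y v)"
    unfolding q' y_def by (simp add: sum_distrib_left mult_ac)
  have "q\<^sup>2 \<le> (\<Sum>r\<in>R. (x r)\<^sup>2) * (\<Sum>v\<in>R. (y v)\<^sup>2)"
    unfolding qy by (rule Cauchy_Schwarz_ineq_sum)
  also have "\<dots> \<le> (\<Sum>r\<in>R. (x r)\<^sup>2) * (2 * D * q)"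
    by (intro mult_left_mono y2 sum_nonneg) auto
  finally have main: "q * q \<le> (2 * D * (\<Sum>r\<in>R. (x r)\<^sup>2)) * q"
    by (simp add: power2_eq_square mult_ac)
  have "q \<le> 2 * D * (\<Sum>r\<in>R. (x r)\<^sup>2)"
  proof (cases "q > 0")
    case True
    with main show ?thesis by simp
  next
    case False
    moreover have "2 * D * (\<Sum>r\<in>R. (x r)\<^sup>2) \<ge> 0" using D by (simp add: sum_nonneg)
    ultimately show ?thesis by linarith
  qed
  then show ?thesis by (simp add: q_def)
qed

text \<open>Up to a factor 2 the symmetric kernel is dominated by \<open>A\<close> plus its
  transpose, where \<open>A\<close> keeps the larger of the two widths. Triangular and built from
  single-width kernels, \<open>A\<close> satisfies the Gram hypothesis, and the bound is uniform
  over all widths at least 1.\<close>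

lemma poisson_form_le:
  fixes \<sigma> t x :: "'a \<Rightarrow> real"
  assumes "finite R" "\<delta> > 0" and \<sigma>: "\<And>r. r \<in> R \<Longrightarrow> \<sigma> r \<ge> 1"
    and sep: "\<And>r s. r \<in> R \<Longrightarrow> s \<in> R \<Longrightarrow> r \<noteq> s \<Longrightarrow> \<bar>t r - t s\<bar> \<ge> \<delta>"
    and x: "\<And>r. r \<in> R \<Longrightarrow> x r \<ge> 0"
  shows "(\<Sum>r\<in>R. \<Sum>s\<in>R. x r * x s * poisson (\<sigma> r + \<sigma> s) (t r - t s))
    \<le> 512 * (1 + 1 / \<delta>) * (\<Sum>r\<in>R. (x r)\<^sup>2)"
proof -
  define A where "A r s = (if \<sigma> s \<le> \<sigma> r then poisson (\<sigma> r) (t r - t s) else 0)" for r s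
  \<comment> \<open>The value 64 is 8 from \<open>poisson_mult_le\<close> times 4 + 4 from two
    applications of \<open>sum_poisson_separated\<close>.\<close>
  define D where "D = 64 * (1 + 1 / \<delta>)"
  have D: "D \<ge> 0" using assms(2) by (simp add: D_def)
  have A_nn: "A r s \<ge> 0" if "r \<in> R" for r s
    using \<sigma>[OF that] by (auto simp: A_def intro: poisson_nonneg)
  have A_le: "A r v \<le> poisson (\<sigma> r) (t r - t v)" if "r \<in> R" for r v
    using \<sigma>[OF that] by (auto simp: A_def intro: poisson_nonneg)
  have gram1: "(\<Sum>v\<in>R. A r v * A s v) \<le> D * (A r s + A s r)"
    if rs: "r \<in> R" "s \<in> R" and le: "\<sigma> s \<le> \<sigma> r" for r s
  proof -
    have pos: "\<sigma> s > 0" "\<sigma> r > 0" using \<sigma> rs by force+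
    let ?P = "poisson (\<sigma> r) (t r - t s)"
    have P: "?P \<ge> 0" using pos by (simp add: poisson_nonneg)
    have "(\<Sum>v\<in>R. A r v * A s v) \<le> (\<Sum>v\<in>R. poisson (\<sigma> r) (t r - t v) * poisson (\<sigma> s) (t s - t v))"
      using A_le A_nn rs pos by (intro sum_mono mult_mono) (auto simp: poisson_nonneg)
    also have "\<dots> \<le> (\<Sum>v\<in>R. 8 * ?P * (poisson (\<sigma> r) (t r - t v) + poisson (\<sigma> s) (t s - t v)))"
      by (intro sum_mono poisson_mult_le le pos)
    also have "\<dots> = 8 * ?P * ((\<Sum>v\<in>R. poisson (\<sigma> r) (t r - t v)) + (\<Sum>v\<in>R. poisson (\<sigma> s) (t s - t v)))"
      by (simp only: sum_distrib_left[symmetric] sum.distrib)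
    also have "\<dots> \<le> 8 * ?P * (4 * (1 + 1 / \<delta>) + 4 * (1 + 1 / \<delta>))"
      using P assms rs by (intro mult_left_mono add_mono sum_poisson_separated) auto
    also have "\<dots> = D * ?P" by (simp add: D_def)
    also have "\<dots> \<le> D * (A r s + A s r)"
      using le A_nn[OF rs(2), of r] by (intro mult_left_mono D) (simp add: A_def[of r s])
    finally show ?thesis .
  qed
  have gram: "(\<Sum>v\<in>R. A r v * A s v) \<le> D * (A r s + A s r)" if "r \<in> R" "s \<in> R" for r s
    using gram1[of r s] gram1[of s r] that by (cases "\<sigma> s \<le> \<sigma> r") (auto simp: mult.commute add.commute)
  have K: "poisson (\<sigma> r + \<sigma> s) (t r - t s) \<le> 2 * (A r s + A s r)" if rs: "r \<in> R" "s \<in> R" for r s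
  proof -
    \<comment> \<open>Replacing the sum of the widths by the larger one at most halves the numerator
      and does not increase the denominator.\<close>
    have *: "poisson (a + b) d \<le> 2 * poisson a d" if "0 < b" "b \<le> a" for a b d :: real
    proof -
      have "a\<^sup>2 \<le> (a + b)\<^sup>2" using that by (intro power_mono) auto
      then have "poisson (a + b) d \<le> (2 * a) / (a\<^sup>2 + d\<^sup>2)"
        unfolding poisson_def using that by (intro frac_le add_pos_nonneg) auto
      then show ?thesis by (simp add: poisson_def)
    qed
    have pos: "\<sigma> s > 0" "\<sigma> r > 0" using \<sigma> rs by force+
    show ?thesis
    proof (cases "\<sigma> s \<le> \<sigma> r")
      case True
      then show ?thesis using *[OF pos(1) True, of "t r - t s"] A_nn[OF rs(2), of r]
        by (simp add: A_def)
    next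
      case False
      then show ?thesis using *[OF pos(2), of "\<sigma> s" "t s - t r"]
        by (simp add: A_def add.commute poisson_minus_commute[of _ "t r"])
    qed
  qed
  have "(\<Sum>r\<in>R. \<Sum>s\<in>R. x r * x s * poisson (\<sigma> r + \<sigma> s) (t r - t s))
    \<le> (\<Sum>r\<in>R. \<Sum>s\<in>R. x r * x s * (2 * (A r s + A s r)))"
    by (intro sum_mono mult_left_mono K mult_nonneg_nonneg x)
  also have "\<dots> = 2 * (\<Sum>r\<in>R. \<Sum>s\<in>R. x r * x s * A r s) + 2 * (\<Sum>r\<in>R. \<Sum>s\<in>R. x r * x s * A s r)"
    by (simp add: sum_distrib_left algebra_simps flip: sum.distrib)
  also have "(\<Sum>r\<in>R. \<Sum>s\<in>R. x r * x s * A s r) = (\<Sum>r\<in>R. \<Sum>s\<in>R. x r * x s * A r s)"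
    by (subst sum.swap) (simp add: mult_ac)
  also have "2 * (\<Sum>r\<in>R. \<Sum>s\<in>R. x r * x s * A r s) + 2 * (\<Sum>r\<in>R. \<Sum>s\<in>R. x r * x s * A r s)
    = 4 * (\<Sum>r\<in>R. \<Sum>s\<in>R. x r * x s * A r s)" by simp
  also have "\<dots> \<le> 4 * (2 * D * (\<Sum>r\<in>R. (x r)\<^sup>2))"
    by (intro mult_left_mono quadratic_form_le_of_gram_le gram D assms(1) x) auto
  finally show ?thesis unfolding D_def by linarith
qed

section \<open>Sobolev inequality, pointwise and with weights\<close>

lemma le_integral_of_derivative_bound:
  fixes f g :: "real \<Rightarrow> real"
  assumes L: "L > 0"
    and f: "\<And>x. x \<in> {y..y+L} \<Longrightarrow> (f has_real_derivative f' x) (at x)"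
    and g: "\<And>x. x \<in> {y..y+L} \<Longrightarrow> \<bar>f' x\<bar> \<le> g x" "continuous_on {y..y+L} g"
  shows "f y \<le> integral {y..y+L} (\<lambda>u. f u / L + g u)"
proof -
  \<comment> \<open>The linear factor runs from -1 at y to 0 at y + L. Hence \<open>F\<close>
    increases by exactly f y over the window, and the factor has modulus at most 1.\<close>
  define F where "F u = ((u - y) / L - 1) * f u" for u
  have F': "(F has_real_derivative (f u / L + ((u - y) / L - 1) * f' u)) (at u)"
    if "u \<in> {y..y+L}" for u
    unfolding F_def using L by (auto intro!: derivative_eq_intros f[OF that] simp: field_simps)
  have "((\<lambda>u. f u / L + ((u - y) / L - 1) * f' u) has_integral (F (y + L) - F y)) {y..y+L}"
    using F' L by (intro fundamental_theorem_of_calculus)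
      (auto simp flip: has_real_derivative_iff_has_vector_derivative
        intro: has_field_derivative_at_within)
  moreover have "F (y + L) - F y = f y" using L by (simp add: F_def)
  ultimately have int1: "((\<lambda>u. f u / L + ((u - y) / L - 1) * f' u) has_integral f y) {y..y+L}"
    by simp
  have "continuous_on {y..y+L} f"
    using f by (meson DERIV_isCont continuous_at_imp_continuous_on)
  then have "continuous_on {y..y+L} (\<lambda>u. f u / L + g u)"
    using g(2) L by (intro continuous_intros) auto
  then have int2: "((\<lambda>u. f u / L + g u) has_integral integral {y..y+L} (\<lambda>u. f u / L + g u)) {y..y+L}"
    by (intro integrable_integral integrable_continuous_real)
  show ?thesis
  proof (rule has_integral_le[OF int1 int2])
    fix u assume u: "u \<in> {y..y+L}"
    have "\<bar>(u - y) / L - 1\<bar> \<le> 1" using u L by (auto simp: abs_le_iff field_simps)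
    then have "\<bar>((u - y) / L - 1) * f' u\<bar> \<le> 1 * g u"
      unfolding abs_mult using g(1)[OF u] by (intro mult_mono) auto
    then show "f u / L + ((u - y) / L - 1) * f' u \<le> f u / L + g u" by linarith
  qed
qed

text \<open>The pointwise inequality is applied on the window to the right of each y j. After
  exchanging sum and integral, the weights of the windows covering a given u add up to at most 1,
  and the integrand is nonnegative.\<close>

lemma weighted_sum_le_integral:
  fixes f g :: "real \<Rightarrow> real" and y w :: "'a \<Rightarrow> real"
  assumes I: "finite I" and L: "L > 0"
    and y: "\<And>j. j \<in> I \<Longrightarrow> 0 \<le> y j \<and> y j + L \<le> Y"
    and w: "\<And>j. j \<in> I \<Longrightarrow> w j \<ge> 0"
    and window: "\<And>u. (\<Sum>j | j \<in> I \<and> y j \<le> u \<and> u \<le> y j + L. w j) \<le> 1"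
    and f: "\<And>x. (f has_real_derivative f' x) (at x)"
    and nonneg: "\<And>x. f x \<ge> 0"
    and g: "\<And>x. \<bar>f' x\<bar> \<le> g x" "continuous_on UNIV g"
  shows "(\<Sum>j\<in>I. w j * f (y j)) \<le> integral {0..Y} (\<lambda>u. f u / L + g u)"
proof -
  define h where "h u = f u / L + g u" for u
  have h_nn: "h u \<ge> 0" for u
    using nonneg[of u] g(1)[of u] L by (simp add: h_def add_nonneg_nonneg)
  have cont: "continuous_on S h" for S
  proof -
    have "continuous_on S f" using f by (meson DERIV_isCont continuous_at_imp_continuous_on)
    moreover have "continuous_on S g" using g(2) continuous_on_subset by blast
    ultimately show ?thesis unfolding h_def using L by (intro continuous_intros) auto
  qed
  have "((\<lambda>u. if u \<in> {y j..y j + L} then h u else 0) has_integral integral {y j..y j + L} h) {0..Y}"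
    if "j \<in> I" for j
    using y[OF that] by (subst has_integral_restrict)
      (auto intro!: integrable_integral integrable_continuous_real cont)
  then have "((\<lambda>u. \<Sum>j\<in>I. w j * (if u \<in> {y j..y j + L} then h u else 0))
      has_integral (\<Sum>j\<in>I. w j * integral {y j..y j + L} h)) {0..Y}"
    by (intro has_integral_sum I has_integral_mult_right)
  moreover have "(h has_integral integral {0..Y} h) {0..Y}"
    by (intro integrable_integral integrable_continuous_real cont)
  moreover have "(\<Sum>j\<in>I. w j * (if u \<in> {y j..y j + L} then h u else 0)) \<le> h u" for u
  proof -
    have "(\<Sum>j\<in>I. w j * (if u \<in> {y j..y j + L} then h u else 0))
      = (\<Sum>j\<in>I. if y j \<le> u \<and> u \<le> y j + L then w j * h u else 0)"
      by (intro sum.cong) auto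
    also have "\<dots> = (\<Sum>j | j \<in> I \<and> y j \<le> u \<and> u \<le> y j + L. w j) * h u"
      using I by (subst sum.inter_filter[symmetric]) (simp_all add: sum_distrib_right)
    also have "\<dots> \<le> 1 * h u" by (intro mult_right_mono window h_nn)
    finally show ?thesis by simp
  qed
  ultimately have "(\<Sum>j\<in>I. w j * integral {y j..y j + L} h) \<le> integral {0..Y} h"
    by (rule has_integral_le)
  moreover have "f (y j) \<le> integral {y j..y j + L} h" for j
    unfolding h_def by (rule le_integral_of_derivative_bound[OF L f g(1)])
      (use g(2) continuous_on_subset in blast)
  then have "(\<Sum>j\<in>I. w j * f (y j)) \<le> (\<Sum>j\<in>I. w j * integral {y j..y j + L} h)"
    using w by (intro sum_mono mult_left_mono)
  ultimately have "(\<Sum>j\<in>I. w j * f (y j)) \<le> integral {0..Y} h" by linarith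
  then show ?thesis by (simp add: h_def[abs_def])
qed

section \<open>Mean squares of exponential sums\<close>

lemma has_integral_exp_minus_complex:
  fixes w :: complex
  assumes "w \<noteq> 0" "Y \<ge> 0"
  shows "((\<lambda>y. exp (- (w * of_real y))) has_integral (1 - exp (- (w * of_real Y))) / w) {0..Y}"
proof -
  have "((\<lambda>y. - exp (- (w * of_real y)) / w) has_vector_derivative exp (- (w * of_real y)))
    (at y within {0..Y})" for y
    using assms(1)
    by (intro has_vector_derivative_real_field)
       (auto intro!: derivative_eq_intros simp: field_simps)
  from fundamental_theorem_of_calculus[OF assms(2) this]
  show ?thesis using assms(1) by (simp add: diff_divide_distrib)
qed

text \<open>The square is expanded as the sum times its conjugate. Positive real parts make every
  \<open>z r + cnj (z s)\<close> nonzero, so each term can be integrated explicitly.\<close>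

lemma has_integral_cmod_exp_sum_squared:
  fixes c z :: "'a \<Rightarrow> complex"
  assumes "finite R" and z: "\<And>r. r \<in> R \<Longrightarrow> Re (z r) > 0" and Y: "Y \<ge> 0"
  shows "((\<lambda>y. (cmod (\<Sum>r\<in>R. c r * exp (- (z r * of_real y))))\<^sup>2) has_integral
    (\<Sum>r\<in>R. \<Sum>s\<in>R. Re (c r * cnj (c s) * ((1 - exp (- ((z r + cnj (z s)) * of_real Y))) / (z r + cnj (z s))))))
    {0..Y}"
proof -
  have expand: "(cmod (\<Sum>r\<in>R. c r * exp (- (z r * of_real y))))\<^sup>2 =
    (\<Sum>r\<in>R. \<Sum>s\<in>R. Re (c r * cnj (c s) * exp (- ((z r + cnj (z s)) * of_real y))))" for y
  proof -
    define S where "S = (\<Sum>r\<in>R. c r * exp (- (z r * of_real y)))"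
    have "(cmod S)\<^sup>2 = Re (S * cnj S)"
      by (simp add: complex_mult_cnj cmod_power2)
    also have "S * cnj S = (\<Sum>r\<in>R. \<Sum>s\<in>R. c r * cnj (c s) * exp (- ((z r + cnj (z s)) * of_real y)))"
      unfolding S_def cnj_sum sum_product
    proof (intro sum.cong refl)
      fix r s
      have "exp (- (z r * of_real y)) * exp (cnj (- (z s * of_real y)))
        = exp (- ((z r + cnj (z s)) * complex_of_real y))"
        unfolding exp_add[symmetric] by (simp add: algebra_simps)
      then show "c r * exp (- (z r * of_real y)) * cnj (c s * exp (- (z s * of_real y)))
        = c r * cnj (c s) * exp (- ((z r + cnj (z s)) * complex_of_real y))"
        by (simp only: complex_cnj_mult exp_cnj mult_ac)
    qed
    finally show ?thesis by (simp add: S_def)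
  qed
  have ne: "z r + cnj (z s) \<noteq> 0" if "r \<in> R" "s \<in> R" for r s
    using z[OF that(1)] z[OF that(2)] by (auto simp: complex_eq_iff)
  show ?thesis unfolding expand
  proof (intro has_integral_sum assms(1))
    fix r s assume rs: "r \<in> R" "s \<in> R"
    have "((\<lambda>y. c r * cnj (c s) * exp (- ((z r + cnj (z s)) * of_real y))) has_integral
      c r * cnj (c s) * ((1 - exp (- ((z r + cnj (z s)) * of_real Y))) / (z r + cnj (z s)))) {0..Y}"
      by (intro has_integral_mult_right has_integral_exp_minus_complex ne rs Y)
    from has_integral_linear[OF this bounded_linear_Re]
    show "((\<lambda>y. Re (c r * cnj (c s) * exp (- ((z r + cnj (z s)) * of_real y)))) has_integral
      Re (c r * cnj (c s) * ((1 - exp (- ((z r + cnj (z s)) * of_real Y))) / (z r + cnj (z s))))) {0..Y}"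
      by (simp add: o_def)
  qed
qed

lemma tendsto_exp_minus_quotient:
  fixes w :: complex
  assumes "Re w > 0"
  shows "((\<lambda>Y. (1 - exp (- (w * of_real Y))) / w) \<longlongrightarrow> 1 / w) at_top"
proof -
  have "filterlim (\<lambda>Y. - Re w * Y) at_bot at_top"
    using assms
    by (intro filterlim_tendsto_neg_mult_at_bot[OF tendsto_const _ filterlim_ident]) simp
  then have "((\<lambda>Y. exp (- Re w * Y)) \<longlongrightarrow> 0) at_top"
    by (rule filterlim_compose[OF exp_at_bot])
  moreover have "(\<lambda>Y. exp (- Re w * Y)) = (\<lambda>Y. norm (exp (- (w * of_real Y))))"
    by simp
  ultimately have "((\<lambda>Y. norm (exp (- (w * of_real Y)))) \<longlongrightarrow> 0) at_top"
    by (simp only:)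
  then have lim: "((\<lambda>Y. exp (- (w * of_real Y))) \<longlongrightarrow> 0) at_top"
    by (rule tendsto_norm_zero_cancel)
  have "w \<noteq> 0" using assms by auto
  with lim have "((\<lambda>Y. (1 - exp (- (w * of_real Y))) / w) \<longlongrightarrow> (1 - 0) / w) at_top"
    by (intro tendsto_divide tendsto_diff tendsto_const)
  then show ?thesis by simp
qed

text \<open>Over the half line alone the cross terms have size \<open>1 / |z\<^sub>r + cnj z\<^sub>s|\<close>, which decays too slowly.
  Extending \<open>exp (- \<sigma> y)\<close> to \<open>exp (- \<sigma> |y|)\<close> on the whole line turns them into Poisson kernels; the
  negative half line contributes the same sum with \<open>z\<^sub>r\<close> replaced by its conjugate.\<close>

lemma integral_exp_sum_squared_le_poisson:
  fixes c z :: "'a \<Rightarrow> complex"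
  assumes "finite R" and z: "\<And>r. r \<in> R \<Longrightarrow> Re (z r) > 0" and Y0: "Y0 \<ge> 0"
  shows "integral {0..Y0} (\<lambda>y. (cmod (\<Sum>r\<in>R. c r * exp (- (z r * of_real y))))\<^sup>2)
    \<le> 2 * (\<Sum>r\<in>R. \<Sum>s\<in>R. cmod (c r) * cmod (c s) * poisson (Re (z r) + Re (z s)) (Im (z r) - Im (z s)))"
proof -
  define E where "E w Y = (1 - exp (- (w * complex_of_real Y))) / w" for w Y
  define f where "f \<zeta> y = (cmod (\<Sum>r\<in>R. c r * exp (- (\<zeta> r * complex_of_real y))))\<^sup>2" for \<zeta> y
  define H where "H \<zeta> Y = (\<Sum>r\<in>R. \<Sum>s\<in>R. Re (c r * cnj (c s) * E (\<zeta> r + cnj (\<zeta> s)) Y))" for \<zeta> Y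
  define z' where "z' r = cnj (z r)" for r
  have int: "(f \<zeta> has_integral H \<zeta> Y) {0..Y}" if "\<And>r. r \<in> R \<Longrightarrow> Re (\<zeta> r) > 0" "Y \<ge> 0" for \<zeta> Y
    unfolding f_def[abs_def] H_def E_def using assms(1) that by (rule has_integral_cmod_exp_sum_squared)
  have z': "Re (z' r) > 0" if "r \<in> R" for r using z[OF that] by (simp add: z'_def)
  have f_nn: "f \<zeta> y \<ge> 0" for \<zeta> y unfolding f_def by (rule zero_le_power2)
  have H_nn: "H z' Y \<ge> 0" if "Y \<ge> 0" for Y
    using int[OF z' that] f_nn by (rule has_integral_nonneg)
  have zint: "(f z has_integral H z Y) {0..Y}" if "Y \<ge> 0" for Y
    by (rule int[OF z that])
  \<comment> \<open>Two nonnegative quantities are added: the integral from \<open>Y0\<close> to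
    \<open>Y\<close>, and the mean square of the sum with conjugated exponents. The limit in
    \<open>Y\<close> then removes the boundary terms.\<close>
  have le: "integral {0..Y0} (f z) \<le> H z Y + H z' Y" if "Y \<ge> Y0" for Y
  proof -
    have "integral {0..Y0} (f z) \<le> integral {0..Y} (f z)"
    proof (rule integral_subset_le)
      show "f z integrable_on {0..Y0}" "f z integrable_on {0..Y}"
        using zint[of Y0] zint[of Y] that Y0 by (auto simp: has_integral_integrable)
      show "\<forall>y\<in>{0..Y}. 0 \<le> f z y" by (intro ballI f_nn)
    qed (use that in auto)
    also have "\<dots> = H z Y" using zint[of Y] that Y0 by (intro integral_unique) auto
    finally show ?thesis using H_nn[of Y] that Y0 by simp
  qed
  have lim: "((\<lambda>Y. H \<zeta> Y) \<longlongrightarrow> (\<Sum>r\<in>R. \<Sum>s\<in>R. Re (c r * cnj (c s) * (1 / (\<zeta> r + cnj (\<zeta> s)))))) at_top"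
    if pos: "\<And>r. r \<in> R \<Longrightarrow> Re (\<zeta> r) > 0" for \<zeta>
    unfolding H_def E_def
    by (intro tendsto_sum tendsto_Re tendsto_mult tendsto_const tendsto_exp_minus_quotient)
       (use pos in \<open>simp add: add_pos_pos\<close>)
  have "integral {0..Y0} (f z) \<le> (\<Sum>r\<in>R. \<Sum>s\<in>R. Re (c r * cnj (c s) * (1 / (z r + cnj (z s)))))
      + (\<Sum>r\<in>R. \<Sum>s\<in>R. Re (c r * cnj (c s) * (1 / (z' r + cnj (z' s)))))"
    by (rule tendsto_lowerbound[OF tendsto_add[OF lim[OF z] lim[OF z']]])
       (auto intro: eventually_mono[OF eventually_ge_at_top[of Y0] le])
  also have "\<dots> = (\<Sum>r\<in>R. \<Sum>s\<in>R. Re (c r * cnj (c s) * (1 / (z r + cnj (z s)) + 1 / (z' r + cnj (z' s)))))"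
    by (simp add: ring_distribs flip: sum.distrib)
  also have "\<dots> \<le> (\<Sum>r\<in>R. \<Sum>s\<in>R. 2 * (cmod (c r) * cmod (c s) * poisson (Re (z r) + Re (z s)) (Im (z r) - Im (z s))))"
  proof (intro sum_mono)
    fix r s assume rs: "r \<in> R" "s \<in> R"
    define w where "w = z r + cnj (z s)"
    have w: "Re w > 0" using z rs by (simp add: w_def add_pos_pos)
    then have w0: "w \<noteq> 0" by auto
    \<comment> \<open>Adding the two half lines cancels the imaginary part and leaves twice the real
      part of 1 / w.\<close>
    have "1 / w + 1 / cnj w = complex_of_real (2 * poisson (Re w) (Im w))"
    proof -
      have "1 / w + 1 / cnj w = (w + cnj w) / (w * cnj w)" using w0 by (simp add: field_simps)
      also have "\<dots> = of_real (2 * Re w) / of_real ((Re w)\<^sup>2 + (Im w)\<^sup>2)"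
        by (simp add: complex_add_cnj complex_mult_cnj)
      finally show ?thesis by (simp add: poisson_def)
    qed
    moreover have "z' r + cnj (z' s) = cnj w" by (simp add: z'_def w_def)
    ultimately have "Re (c r * cnj (c s) * (1 / (z r + cnj (z s)) + 1 / (z' r + cnj (z' s))))
      \<le> cmod (c r * cnj (c s) * complex_of_real (2 * poisson (Re w) (Im w)))"
      by (metis complex_Re_le_cmod w_def)
    also have "\<dots> = 2 * (cmod (c r) * cmod (c s) * poisson (Re w) (Im w))"
      using w by (simp add: norm_mult poisson_nonneg)
    finally show "Re (c r * cnj (c s) * (1 / (z r + cnj (z s)) + 1 / (z' r + cnj (z' s))))
      \<le> 2 * (cmod (c r) * cmod (c s) * poisson (Re (z r) + Re (z s)) (Im (z r) - Im (z s)))"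
      by (simp add: w_def)
  qed
  finally show ?thesis by (simp add: f_def[abs_def] sum_distrib_left)
qed

text \<open>The Carleson embedding for points with separated imaginary parts: the bound depends
  neither on \<open>Y\<close> nor on how large the real parts are.\<close>

lemma integral_exp_sum_squared_le:
  fixes c z :: "'a \<Rightarrow> complex"
  assumes "finite R" "\<delta> > 0" "Y \<ge> 0" and z: "\<And>r. r \<in> R \<Longrightarrow> Re (z r) \<ge> 1"
    and sep: "\<And>r s. r \<in> R \<Longrightarrow> s \<in> R \<Longrightarrow> r \<noteq> s \<Longrightarrow> \<bar>Im (z r) - Im (z s)\<bar> \<ge> \<delta>"
  shows "integral {0..Y} (\<lambda>y. (cmod (\<Sum>r\<in>R. c r * exp (- (z r * of_real y))))\<^sup>2)
    \<le> 1024 * (1 + 1 / \<delta>) * (\<Sum>r\<in>R. (cmod (c r))\<^sup>2)"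
proof -
  have "integral {0..Y} (\<lambda>y. (cmod (\<Sum>r\<in>R. c r * exp (- (z r * of_real y))))\<^sup>2)
    \<le> 2 * (\<Sum>r\<in>R. \<Sum>s\<in>R. cmod (c r) * cmod (c s) * poisson (Re (z r) + Re (z s)) (Im (z r) - Im (z s)))"
    using z by (intro integral_exp_sum_squared_le_poisson assms(1,3)) (force intro: less_le_trans[of 0 1])
  also have "\<dots> \<le> 2 * (512 * (1 + 1 / \<delta>) * (\<Sum>r\<in>R. (cmod (c r))\<^sup>2))"
    using assms by (intro mult_left_mono poisson_form_le) auto
  finally show ?thesis by linarith
qed

section \<open>Duality and the dual large sieve bound\<close>

text \<open>An operator and its transpose have the same norm, here between weighted square-summable
  spaces; the weight passes to the other side as its reciprocal.\<close>

lemma dual_large_sieve: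
  fixes e :: "'a \<Rightarrow> 'b \<Rightarrow> complex"
  assumes B: "B \<ge> 0" and w: "\<And>j. j \<in> I \<Longrightarrow> w j > 0"
    and dual: "\<And>c. (\<Sum>j\<in>I. w j * (cmod (\<Sum>r\<in>R. c r * e r j))\<^sup>2) \<le> B * (\<Sum>r\<in>R. (cmod (c r))\<^sup>2)"
  shows "(\<Sum>r\<in>R. (cmod (\<Sum>j\<in>I. a j * e r j))\<^sup>2) \<le> B * (\<Sum>j\<in>I. (cmod (a j))\<^sup>2 / w j)"
proof -
  \<comment> \<open>With the conjugates of the sums themselves as coefficients, the bilinear form
    equals the quantity \<open>Q\<close> to be bounded, and Cauchy-Schwarz gives a bound for
    \<open>Q\<close> squared that is linear in \<open>Q\<close>.\<close>
  define c where "c r = cnj (\<Sum>j\<in>I. a j * e r j)" for r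
  define Q where "Q = (\<Sum>r\<in>R. (cmod (c r))\<^sup>2)"
  define V where "V = (\<Sum>j\<in>I. (cmod (a j))\<^sup>2 / w j)"
  have Q: "(\<Sum>r\<in>R. (cmod (\<Sum>j\<in>I. a j * e r j))\<^sup>2) = Q" by (simp only: Q_def c_def complex_mod_cnj)
  have V: "V \<ge> 0" unfolding V_def using w by (intro sum_nonneg divide_nonneg_pos) auto
  have "complex_of_real Q = (\<Sum>r\<in>R. c r * (\<Sum>j\<in>I. a j * e r j))"
    by (simp only: Q_def c_def of_real_sum complex_norm_square complex_cnj_cnj)
  also have "\<dots> = (\<Sum>j\<in>I. a j * (\<Sum>r\<in>R. c r * e r j))"
    unfolding sum_distrib_left by (subst sum.swap) (simp add: mult_ac)
  finally have "cmod (complex_of_real Q) \<le> (\<Sum>j\<in>I. cmod (a j) * cmod (\<Sum>r\<in>R. c r * e r j))"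
    by (simp only:) (rule order_trans[OF norm_sum], simp add: norm_mult)
  moreover have Q0: "Q \<ge> 0" unfolding Q_def by (intro sum_nonneg) auto
  ultimately have "Q \<le> (\<Sum>j\<in>I. (cmod (a j) / sqrt (w j)) * (sqrt (w j) * cmod (\<Sum>r\<in>R. c r * e r j)))"
    using w by (simp add: less_imp_neq[symmetric])
  then have "Q\<^sup>2 \<le> (\<Sum>j\<in>I. (cmod (a j) / sqrt (w j)) * (sqrt (w j) * cmod (\<Sum>r\<in>R. c r * e r j)))\<^sup>2"
    using Q0 by (rule power_mono)
  also have "\<dots> \<le> (\<Sum>j\<in>I. (cmod (a j) / sqrt (w j))\<^sup>2) * (\<Sum>j\<in>I. (sqrt (w j) * cmod (\<Sum>r\<in>R. c r * e r j))\<^sup>2)"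
    by (rule Cauchy_Schwarz_ineq_sum)
  also have "\<dots> = V * (\<Sum>j\<in>I. w j * (cmod (\<Sum>r\<in>R. c r * e r j))\<^sup>2)"
    using w by (simp add: V_def power_divide power_mult_distrib less_imp_le)
  also have "\<dots> \<le> V * (B * Q)"
    using dual[of c] V by (intro mult_left_mono) (simp_all add: Q_def)
  finally have "Q * Q \<le> (B * V) * Q" by (simp add: power2_eq_square mult_ac)
  then have "Q \<le> B * V" using Q0 B V by (cases "Q = 0") (auto simp: mult_le_cancel_right)
  then show ?thesis unfolding Q V_def .
qed

text \<open>The weighted Sobolev inequality for |G|^2 combined with the embedding for G and for its
  derivative. The total cost is 1 / L + lam + 4 lam, at most 7 lam, times 1024 (1 + 1 /
  \<delta>).\<close>

lemma dual_exp_sum_bound: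
  fixes c z :: "'a \<Rightarrow> complex" and y w :: "'b \<Rightarrow> real"
  assumes R: "finite R" and \<delta>: "\<delta> > 0" and z: "\<And>r. r \<in> R \<Longrightarrow> Re (z r) \<ge> 1"
    and z_le: "\<And>r. r \<in> R \<Longrightarrow> cmod (z r) \<le> 2 * lam"
    and sep: "\<And>r s. r \<in> R \<Longrightarrow> s \<in> R \<Longrightarrow> r \<noteq> s \<Longrightarrow> \<bar>Im (z r) - Im (z s)\<bar> \<ge> \<delta>"
    and L: "L > 0" "1 / L \<le> 2 * lam"
    and I: "finite I"
    and y: "\<And>j. j \<in> I \<Longrightarrow> 0 \<le> y j \<and> y j + L \<le> Y" and Y: "Y \<ge> 0"
    and w: "\<And>j. j \<in> I \<Longrightarrow> w j \<ge> 0"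
    and window: "\<And>u. (\<Sum>j | j \<in> I \<and> y j \<le> u \<and> u \<le> y j + L. w j) \<le> 1"
  shows "(\<Sum>j\<in>I. w j * (cmod (\<Sum>r\<in>R. c r * exp (- (z r * of_real (y j)))))\<^sup>2)
    \<le> 7168 * lam * (1 + 1 / \<delta>) * (\<Sum>r\<in>R. (cmod (c r))\<^sup>2)"
proof -
  define G where "G d x = (\<Sum>r\<in>R. d r * exp (- (z r * complex_of_real x)))" for d x
  define d where "d r = - (c r * z r)" for r
  define K where "K = 1024 * (1 + 1 / \<delta>)"
  define Q where "Q = (\<Sum>r\<in>R. (cmod (c r))\<^sup>2)"
  have lam: "lam > 0" using L zero_less_divide_1_iff[of L] by linarith
  have K: "K \<ge> 0" using \<delta> by (simp add: K_def)
  have Q: "Q \<ge> 0" unfolding Q_def by (intro sum_nonneg) auto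
  define f' where "f' x = 2 * (Re (G c x) * Re (G d x) + Im (G c x) * Im (G d x))" for x
  \<comment> \<open>Weighted arithmetic-geometric mean bound for the derivative of |G|^2.
    Differentiation multiplies coefficients by at most 2 lam in modulus, so with this weight both
    terms are of order lam in the mean.\<close>
  define g where "g x = lam * (cmod (G c x))\<^sup>2 + (cmod (G d x))\<^sup>2 / lam" for x
  have vd: "(G c has_vector_derivative G d x) (at x)" for x
    unfolding G_def[abs_def] d_def
    by (intro has_vector_derivative_sum has_vector_derivative_real_field)
       (auto intro!: derivative_eq_intros simp: algebra_simps)
  have "((\<lambda>x. (Re (G c x))\<^sup>2 + (Im (G c x))\<^sup>2) has_real_derivative f' x) (at x)" for x
  proof -
    have "((\<lambda>x. Re (G c x)) has_real_derivative Re (G d x)) (at x)"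
      "((\<lambda>x. Im (G c x)) has_real_derivative Im (G d x)) (at x)"
      unfolding has_real_derivative_iff_has_vector_derivative
      using bounded_linear.has_vector_derivative[OF bounded_linear_Re vd]
        bounded_linear.has_vector_derivative[OF bounded_linear_Im vd] by auto
    from DERIV_add[OF DERIV_power[OF this(1), of 2] DERIV_power[OF this(2), of 2]]
    show ?thesis by (simp add: f'_def algebra_simps)
  qed
  then have f: "((\<lambda>x. (cmod (G c x))\<^sup>2) has_real_derivative f' x) (at x)" for x
    by (simp add: cmod_power2)
  have contG: "continuous_on S (G e)" for S e
    unfolding G_def[abs_def] by (intro continuous_intros)
  have g: "\<bar>f' x\<bar> \<le> g x" for x
  proof -
    define p q where "p = cmod (G c x)" and "q = cmod (G d x)"
    have "f' x = 2 * Re (G c x * cnj (G d x))" by (simp add: f'_def)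
    then have "\<bar>f' x\<bar> \<le> 2 * (p * q)"
      using abs_Re_le_cmod[of "G c x * cnj (G d x)"] by (simp add: norm_mult p_def q_def)
    also have "2 * (p * q) \<le> lam * p\<^sup>2 + q\<^sup>2 / lam"
    proof -
      have "0 \<le> (lam * p - q)\<^sup>2 / lam" using lam by simp
      also have "\<dots> = lam * p\<^sup>2 + q\<^sup>2 / lam - 2 * (p * q)"
        using lam by (simp add: power2_eq_square field_simps)
      finally show ?thesis by simp
    qed
    finally show ?thesis by (simp add: g_def p_def q_def)
  qed
  have "continuous_on UNIV g"
    unfolding g_def[abs_def] using lam by (intro continuous_intros contG) auto
  from weighted_sum_le_integral[OF I L(1) y w window f _ g this]
  have "(\<Sum>j\<in>I. w j * (cmod (G c (y j)))\<^sup>2) \<le> integral {0..Y} (\<lambda>u. (cmod (G c u))\<^sup>2 / L + g u)"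
    by simp
  also have "\<dots> = integral {0..Y} (\<lambda>u. (1 / L + lam) * (cmod (G c u))\<^sup>2 + (1 / lam) * (cmod (G d u))\<^sup>2)"
    by (simp add: g_def algebra_simps)
  also have "\<dots> = (1 / L + lam) * integral {0..Y} (\<lambda>u. (cmod (G c u))\<^sup>2)
      + (1 / lam) * integral {0..Y} (\<lambda>u. (cmod (G d u))\<^sup>2)"
    by (subst integral_add)
       (auto intro!: integrable_continuous_real continuous_intros contG simp del: times_divide_eq_left)
  also have "\<dots> \<le> (1 / L + lam) * (K * Q) + (1 / lam) * (K * (4 * lam\<^sup>2 * Q))"
  proof (intro add_mono mult_left_mono)
    show "integral {0..Y} (\<lambda>u. (cmod (G c u))\<^sup>2) \<le> K * Q"
      unfolding G_def K_def Q_def by (intro integral_exp_sum_squared_le R \<delta> Y z sep)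
    have "integral {0..Y} (\<lambda>u. (cmod (G d u))\<^sup>2) \<le> K * (\<Sum>r\<in>R. (cmod (d r))\<^sup>2)"
      unfolding G_def K_def by (intro integral_exp_sum_squared_le R \<delta> Y z sep)
    also have "(\<Sum>r\<in>R. (cmod (d r))\<^sup>2) \<le> (\<Sum>r\<in>R. 4 * lam\<^sup>2 * (cmod (c r))\<^sup>2)"
    proof (rule sum_mono)
      fix r assume "r \<in> R"
      then have "(cmod (z r))\<^sup>2 \<le> (2 * lam)\<^sup>2" by (intro power_mono z_le) auto
      then have "(cmod (c r))\<^sup>2 * (cmod (z r))\<^sup>2 \<le> (cmod (c r))\<^sup>2 * (2 * lam)\<^sup>2"
        by (intro mult_left_mono) auto
      then show "(cmod (d r))\<^sup>2 \<le> 4 * lam\<^sup>2 * (cmod (c r))\<^sup>2"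
        by (simp add: d_def norm_mult power_mult_distrib mult_ac)
    qed
    finally show "integral {0..Y} (\<lambda>u. (cmod (G d u))\<^sup>2) \<le> K * (4 * lam\<^sup>2 * Q)"
      using K by (simp add: Q_def sum_distrib_left mult_left_mono)
  qed (use L lam in auto)
  also have "\<dots> = (1 / L + 5 * lam) * (K * Q)"
    using lam by (simp add: field_simps power2_eq_square)
  also have "\<dots> \<le> (7 * lam) * (K * Q)"
    using L K Q by (intro mult_right_mono) auto
  also have "\<dots> = 7168 * lam * (1 + 1 / \<delta>) * Q" by (simp add: K_def)
  finally show ?thesis by (simp add: G_def Q_def)
qed

section \<open>The counting function as a source of weights\<close>

text \<open>The logarithm has slope at least 1 / (2 N) on [N, 2 N]; the proof obtains this from ln x
  \<le> x - 1 at the quotient of the two points.\<close>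

lemma abs_diff_le_ln_diff:
  fixes N p q :: real
  assumes "N > 0" "p \<in> {N..2 * N}" "q \<in> {N..2 * N}"
  shows "\<bar>p - q\<bar> \<le> 2 * N * \<bar>ln (p / N) - ln (q / N)\<bar>"
proof -
  have *: "p - q \<le> 2 * N * (ln (p / N) - ln (q / N))"
    if "p \<in> {N..2 * N}" "q \<in> {N..2 * N}" "q \<le> p" for p q
  proof -
    have pos: "p > 0" "q > 0" using that assms(1) by auto
    have "ln (q / p) \<le> q / p - 1" using pos by (intro ln_le_minus_one) auto
    then have "(p - q) / p \<le> ln (p / N) - ln (q / N)"
      using pos assms(1) by (simp add: ln_div diff_divide_distrib)
    then have "p - q \<le> p * (ln (p / N) - ln (q / N))"
      using pos by (simp add: field_simps)
    also have "\<dots> \<le> 2 * N * (ln (p / N) - ln (q / N))"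
      using that pos assms(1) by (intro mult_right_mono) (auto simp: divide_right_mono)
    finally show ?thesis .
  qed
  show ?thesis
  proof (cases "q \<le> p")
    case True
    then have "\<bar>p - q\<bar> = p - q" by simp
    also have "\<dots> \<le> 2 * N * (ln (p / N) - ln (q / N))" by (rule *[OF assms(2,3) True])
    also have "\<dots> \<le> 2 * N * \<bar>ln (p / N) - ln (q / N)\<bar>"
      using assms(1) by (intro mult_left_mono) auto
    finally show ?thesis .
  next
    case False
    then have "\<bar>p - q\<bar> = q - p" by simp
    also have "\<dots> \<le> 2 * N * (ln (q / N) - ln (p / N))"
      using False by (intro *[OF assms(3,2)]) simp
    also have "\<dots> \<le> 2 * N * \<bar>ln (p / N) - ln (q / N)\<bar>"
      using assms(1) by (intro mult_left_mono) auto
    finally show ?thesis .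
  qed
qed

lemma chi_pos: "j \<in> {1..J} \<Longrightarrow> lam \<ge> 0 \<Longrightarrow> chi J n (n j) lam > 0"
  unfolding chi_def by (auto simp: card_gt_0_iff)

text \<open>Points whose windows contain u have logarithms within \<eta> / 2 of each other, hence
  lie within \<eta> N of each other. Each of them is therefore counted together with all the others,
  and its weight is at most the reciprocal of their number.\<close>

lemma chi_window:
  assumes N: "N > 0" and n: "\<And>j. j \<in> {1..J} \<Longrightarrow> N \<le> n j \<and> n j \<le> 2 * N"
  shows "(\<Sum>j | j \<in> {1..J} \<and> ln (n j / N) \<le> u \<and> u \<le> ln (n j / N) + \<eta> / 2.
    1 / real (chi J n (n j) (\<eta> * N))) \<le> 1"
proof -
  define W where "W = {j. j \<in> {1..J} \<and> ln (n j / N) \<le> u \<and> u \<le> ln (n j / N) + \<eta> / 2}"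
  have W: "finite W" unfolding W_def by simp
  have "1 / real (chi J n (n j) (\<eta> * N)) \<le> 1 / real (card W)" if j: "j \<in> W" for j
  proof -
    have "W \<subseteq> {k \<in> {1..J}. \<bar>n j - n k\<bar> \<le> \<eta> * N}"
    proof
      fix k assume k: "k \<in> W"
      have "\<bar>n j - n k\<bar> \<le> 2 * N * \<bar>ln (n j / N) - ln (n k / N)\<bar>"
        using j k n N by (intro abs_diff_le_ln_diff) (auto simp: W_def)
      also have "\<bar>ln (n j / N) - ln (n k / N)\<bar> \<le> \<eta> / 2"
        using j k unfolding W_def abs_le_iff by auto
      finally have "\<bar>n j - n k\<bar> \<le> \<eta> * N" using N by (simp add: mult_ac)
      then show "k \<in> {k \<in> {1..J}. \<bar>n j - n k\<bar> \<le> \<eta> * N}" using k by (auto simp: W_def)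
    qed
    then have "card W \<le> chi J n (n j) (\<eta> * N)"
      unfolding chi_def by (intro card_mono) auto
    moreover have "card W > 0" using W j by (auto simp: card_gt_0_iff)
    ultimately show ?thesis by (intro divide_left_mono) auto
  qed
  then have "(\<Sum>j\<in>W. 1 / real (chi J n (n j) (\<eta> * N))) \<le> (\<Sum>j\<in>W. 1 / real (card W))"
    by (rule sum_mono)
  also have "\<dots> \<le> 1" by simp
  finally show ?thesis by (simp add: W_def)
qed

text \<open>The dual factor in Cauchy-Schwarz for a single s. For \<eta> \<ge> 1 every count is J.
  Otherwise the Sobolev bound gives at most (2 / \<eta> + 2 \<sigma>) / (2 \<sigma>), and this is at
  most 2 exactly when \<sigma> \<ge> 1 / \<eta>.\<close>

lemma sum_exp_div_chi_le:
  assumes N: "N > 0" and n: "\<And>j. j \<in> {1..J} \<Longrightarrow> N \<le> n j \<and> n j \<le> 2 * N" and \<eta>: "\<eta> > 0"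
    and \<sigma>: "\<sigma> > 0" "\<eta> \<ge> 1 \<or> \<sigma> \<ge> 1 / \<eta>"
  shows "(\<Sum>j = 1..J. 1 / real (chi J n (n j) (\<eta> * N)) * exp (- (2 * \<sigma> * ln (n j / N)))) \<le> 2"
proof (cases "\<eta> \<ge> 1")
  case True
  have "1 / real (chi J n (n j) (\<eta> * N)) * exp (- (2 * \<sigma> * ln (n j / N))) \<le> 1 / real J"
    if j: "j \<in> {1..J}" for j
  proof -
    have "\<bar>n j - n k\<bar> \<le> \<eta> * N" if k: "k \<in> {1..J}" for k
    proof -
      have "\<bar>n j - n k\<bar> \<le> 1 * N" using n[OF j] n[OF k] by auto
      also have "\<dots> \<le> \<eta> * N" using True N by (intro mult_right_mono) auto
      finally show ?thesis .
    qed
    then have "{k \<in> {1..J}. \<bar>n j - n k\<bar> \<le> \<eta> * N} = {1..J}" by blast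
    then have "chi J n (n j) (\<eta> * N) = J" by (simp add: chi_def)
    moreover have "exp (- (2 * \<sigma> * ln (n j / N))) \<le> 1" using n[OF j] N \<sigma> by simp
    ultimately show ?thesis by (simp add: divide_right_mono)
  qed
  then have "(\<Sum>j = 1..J. 1 / real (chi J n (n j) (\<eta> * N)) * exp (- (2 * \<sigma> * ln (n j / N))))
    \<le> (\<Sum>j = 1..J. 1 / real J)" by (rule sum_mono)
  also have "\<dots> \<le> 2" by simp
  finally show ?thesis .
next
  case False
  then have \<sigma>\<eta>: "\<sigma> \<ge> 1 / \<eta>" using \<sigma> by simp
  define f where "f x = exp (- (2 * \<sigma> * x))" for x
  define f' where "f' x = - (2 * \<sigma>) * f x" for x
  have ln: "0 \<le> ln (n j / N) \<and> ln (n j / N) + \<eta> / 2 \<le> 2" if "j \<in> {1..J}" for j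
  proof -
    have "1 \<le> n j / N" "n j / N \<le> 2" using n[OF that] N by (auto simp: field_simps)
    then have "ln (n j / N) \<ge> 0" "ln (n j / N) \<le> ln 2" by auto
    moreover have "ln 2 \<le> (1::real)" using ln_le_minus_one[of 2] by simp
    ultimately show ?thesis using False by linarith
  qed
  have f: "(f has_real_derivative f' x) (at x)" for x
    unfolding f_def[abs_def] f'_def by (auto intro!: derivative_eq_intros)
  have "(\<Sum>j = 1..J. 1 / real (chi J n (n j) (\<eta> * N)) * f (ln (n j / N)))
    \<le> integral {0..2} (\<lambda>u. f u / (\<eta> / 2) + 2 * \<sigma> * f u)"
  proof (rule weighted_sum_le_integral)
    show "\<bar>f' x\<bar> \<le> 2 * \<sigma> * f x" for x using \<sigma> by (simp add: f'_def f_def abs_mult)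
    show "continuous_on UNIV (\<lambda>x. 2 * \<sigma> * f x)" unfolding f_def by (intro continuous_intros)
    show "f x \<ge> 0" for x by (simp add: f_def)
  qed (use f chi_window[OF N n] ln \<eta> in auto)
  also have "((\<lambda>u. f u / (\<eta> / 2) + 2 * \<sigma> * f u) has_integral
    ((2 / \<eta> + 2 * \<sigma>) * (- f 2 / (2 * \<sigma>)) - (2 / \<eta> + 2 * \<sigma>) * (- f 0 / (2 * \<sigma>)))) {0..2}"
  proof (rule fundamental_theorem_of_calculus)
    fix x :: real
    have "((\<lambda>x. (2 / \<eta> + 2 * \<sigma>) * (- f x / (2 * \<sigma>))) has_real_derivative
      f x / (\<eta> / 2) + 2 * \<sigma> * f x) (at x)"
      using \<sigma> \<eta> by (auto intro!: derivative_eq_intros f simp: f'_def field_simps)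
    then show "((\<lambda>x. (2 / \<eta> + 2 * \<sigma>) * (- f x / (2 * \<sigma>))) has_vector_derivative
      f x / (\<eta> / 2) + 2 * \<sigma> * f x) (at x within {0..2})"
      by (simp add: has_real_derivative_iff_has_vector_derivative has_vector_derivative_at_within)
  qed simp
  then have "integral {0..2} (\<lambda>u. f u / (\<eta> / 2) + 2 * \<sigma> * f u)
    = (2 / \<eta> + 2 * \<sigma>) / (2 * \<sigma>) * (1 - f 2)"
  proof (subst integral_unique, assumption)
    have "f 0 = 1" by (simp add: f_def)
    then show "(2 / \<eta> + 2 * \<sigma>) * (- f 2 / (2 * \<sigma>)) - (2 / \<eta> + 2 * \<sigma>) * (- f 0 / (2 * \<sigma>))
      = (2 / \<eta> + 2 * \<sigma>) / (2 * \<sigma>) * (1 - f 2)"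
      by (simp only:) (simp add: right_diff_distrib)
  qed
  also have "\<dots> \<le> 2 * 1"
  proof (intro mult_mono)
    show "(2 / \<eta> + 2 * \<sigma>) / (2 * \<sigma>) \<le> 2" using \<sigma>\<eta> \<sigma>(1) \<eta> by (simp add: field_simps)
  qed (use \<sigma> in \<open>auto simp: f_def\<close>)
  finally show ?thesis by (simp add: f_def)
qed

section \<open>Dirichlet polynomials as exponential sums, and the final estimate\<close>

lemma powr_minus_eq_exp_ln:
  assumes "N > 0" "p > 0"
  shows "complex_of_real p powr (- s)
    = complex_of_real N powr (- s) * exp (- (s * complex_of_real (ln (p / N))))"
proof -
  have "ln p = ln N + ln (p / N)" using assms by (simp add: ln_div)
  then have "complex_of_real (ln p) = complex_of_real (ln N) + complex_of_real (ln (p / N))"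
    by (metis of_real_add)
  then show ?thesis using assms
    by (simp add: powr_def Ln_of_real exp_add[symmetric] ring_distribs)
qed

lemma dirichlet_poly_eq:
  assumes N: "N > 0" and n: "\<And>j. j \<in> {1..J} \<Longrightarrow> N \<le> n j"
  shows "dirichlet_poly J n a s
    = complex_of_real N powr (- s) * (\<Sum>j = 1..J. a j * exp (- (s * complex_of_real (ln (n j / N)))))"
proof -
  have "n j > 0" if "j \<in> {1..J}" for j using n[OF that] N by simp
  then show ?thesis
    unfolding dirichlet_poly_def sum_distrib_left
    using powr_minus_eq_exp_ln[OF N] by (intro sum.cong refl) (simp add: mult_ac)
qed

lemma cmod_powr_minus_squared_le:
  fixes N :: real
  assumes "N \<ge> 1" "Re s \<ge> \<alpha>"
  shows "(cmod (complex_of_real N powr (- s)))\<^sup>2 \<le> 1 / N powr (2 * \<alpha>)"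
proof -
  have "cmod (complex_of_real N powr (- s)) = N powr (- Re s)"
    using assms by (simp add: norm_powr_real_powr)
  also have "(N powr (- Re s))\<^sup>2 = N powr (- (2 * Re s))"
    using assms by (simp add: power2_eq_square powr_add[symmetric])
  also have "\<dots> \<le> N powr (- (2 * \<alpha>))" using assms by (intro powr_mono) auto
  also have "\<dots> = 1 / N powr (2 * \<alpha>)" by (simp add: powr_minus_divide)
  finally show ?thesis .
qed

text \<open>Cauchy-Schwarz weighted by the counts. For these s no averaging over the set is
  required, since the dual factor is already bounded by an absolute constant.\<close>

lemma dirichlet_poly_squared_le:
  fixes N :: real
  assumes N: "N \<ge> 1" and n: "\<And>j. j \<in> {1..J} \<Longrightarrow> N \<le> n j \<and> n j \<le> 2 * N" and \<eta>: "\<eta> > 0"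
    and s: "Re s \<ge> \<alpha>" "Re s > 0" "\<eta> \<ge> 1 \<or> Re s \<ge> 1 / \<eta>"
  shows "(cmod (dirichlet_poly J n a s))\<^sup>2
    \<le> 2 * (\<Sum>j = 1..J. real (chi J n (n j) (\<eta> * N)) * (cmod (a j))\<^sup>2 / N powr (2 * \<alpha>))"
proof -
  define X where "X j = real (chi J n (n j) (\<eta> * N))" for j
  define b where "b j = exp (- (Re s * ln (n j / N)))" for j
  have X: "X j > 0" if "j \<in> {1..J}" for j using chi_pos[OF that] N \<eta> by (simp add: X_def)
  have "cmod (\<Sum>j = 1..J. a j * exp (- (s * complex_of_real (ln (n j / N)))))
    \<le> (\<Sum>j = 1..J. cmod (a j) * b j)"
    by (rule order_trans[OF norm_sum]) (simp add: norm_mult b_def)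
  also have "\<dots> = (\<Sum>j = 1..J. (sqrt (X j) * cmod (a j)) * (b j / sqrt (X j)))"
    using X by (intro sum.cong refl) (auto simp: less_imp_neq[symmetric])
  finally have "(cmod (\<Sum>j = 1..J. a j * exp (- (s * complex_of_real (ln (n j / N))))))\<^sup>2
    \<le> (\<Sum>j = 1..J. (sqrt (X j) * cmod (a j)) * (b j / sqrt (X j)))\<^sup>2"
    by (intro power_mono) auto
  also have "\<dots> \<le> (\<Sum>j = 1..J. (sqrt (X j) * cmod (a j))\<^sup>2) * (\<Sum>j = 1..J. (b j / sqrt (X j))\<^sup>2)"
    by (rule Cauchy_Schwarz_ineq_sum)
  also have "(\<Sum>j = 1..J. (sqrt (X j) * cmod (a j))\<^sup>2) = (\<Sum>j = 1..J. X j * (cmod (a j))\<^sup>2)"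
    by (simp add: power_mult_distrib X_def)
  also have "(\<Sum>j = 1..J. (b j / sqrt (X j))\<^sup>2) = (\<Sum>j = 1..J. 1 / X j * exp (- (2 * Re s * ln (n j / N))))"
    by (intro sum.cong refl) (simp add: power_divide X_def b_def exp_double[symmetric])
  also have "(\<Sum>j = 1..J. X j * (cmod (a j))\<^sup>2) * (\<Sum>j = 1..J. 1 / X j * exp (- (2 * Re s * ln (n j / N))))
    \<le> (\<Sum>j = 1..J. X j * (cmod (a j))\<^sup>2) * 2"
    unfolding X_def using N n \<eta> s
    by (intro mult_left_mono sum_exp_div_chi_le sum_nonneg) auto
  finally have le: "(cmod (\<Sum>j = 1..J. a j * exp (- (s * complex_of_real (ln (n j / N))))))\<^sup>2
    \<le> (\<Sum>j = 1..J. X j * (cmod (a j))\<^sup>2) * 2" .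
  have "(cmod (dirichlet_poly J n a s))\<^sup>2 = (cmod (complex_of_real N powr (- s)))\<^sup>2 *
    (cmod (\<Sum>j = 1..J. a j * exp (- (s * complex_of_real (ln (n j / N))))))\<^sup>2"
    using N n by (subst dirichlet_poly_eq[of N]) (auto simp: norm_mult power_mult_distrib)
  also have "\<dots> \<le> 1 / N powr (2 * \<alpha>) * ((\<Sum>j = 1..J. X j * (cmod (a j))\<^sup>2) * 2)"
    by (intro mult_mono cmod_powr_minus_squared_le N s le) auto
  finally show ?thesis by (simp add: X_def sum_divide_distrib[symmetric] mult_ac)
qed

text \<open>The margins \<delta> / 2 at both ends confine the shifted ordinates to
  [0, T - \<delta>]. This saves the extra 1 of the pigeonhole count and gives T / \<delta>
  itself.\<close>

lemma admissible_card_le: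
  assumes "admissible \<alpha> \<delta> T0 T SS" "\<delta> > 0" "finite SS" "T > 0"
  shows "real (card SS) \<le> T / \<delta>"
proof (cases "SS = {}")
  case True
  then show ?thesis using assms by simp
next
  case False
  define u where "u s = Im s - (T0 + \<delta> / 2)" for s
  define k where "k s = nat \<lfloor>u s / \<delta>\<rfloor>" for s
  have u: "0 \<le> u s" "u s \<le> T - \<delta>" if "s \<in> SS" for s
    using assms(1) that by (auto simp: u_def admissible_def)
  then have T: "T - \<delta> \<ge> 0" using False by force
  have "inj_on k SS" unfolding k_def
    by (rule inj_on_nat_floor_divide) (use assms(1,2) u in \<open>auto simp: u_def admissible_def\<close>)
  moreover have "k ` SS \<subseteq> {..nat \<lfloor>(T - \<delta>) / \<delta>\<rfloor>}"
    using u assms(2) by (auto simp: k_def intro!: nat_mono floor_mono divide_right_mono)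
  ultimately have "card SS \<le> card {..nat \<lfloor>(T - \<delta>) / \<delta>\<rfloor>}"
    by (intro card_inj_on_le) auto
  then have "card SS \<le> Suc (nat \<lfloor>(T - \<delta>) / \<delta>\<rfloor>)" by simp
  moreover have "real (nat \<lfloor>(T - \<delta>) / \<delta>\<rfloor>) \<le> (T - \<delta>) / \<delta>"
    using T assms(2) by simp
  ultimately have "real (card SS) \<le> 1 + (T - \<delta>) / \<delta>" by linarith
  then show ?thesis using assms(2) by (simp add: diff_divide_distrib)
qed

lemma sum_dirichlet_poly_squared_le_near:
  fixes N :: real
  assumes adm: "admissible \<alpha> \<delta> T0 T R" and R: "finite R" and \<delta>: "\<delta> > 0" and T: "T > 0" and \<alpha>: "\<alpha> \<ge> 0"
    and N: "N \<ge> 1" and n: "\<And>j. j \<in> {1..J} \<Longrightarrow> N \<le> n j \<and> n j \<le> 2 * N" and \<eta>: "0 < \<eta>" "\<eta> < 1"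
    and near: "\<And>s. s \<in> R \<Longrightarrow> Re s \<le> 1 / \<eta>"
  shows "(\<Sum>s\<in>R. (cmod (dirichlet_poly J n a s))\<^sup>2) \<le> 28672 * ((T + 1 / \<eta>) * (1 + 1 / \<delta>)) *
    (\<Sum>j = 1..J. real (chi J n (n j) (\<eta> * N)) * (cmod (a j))\<^sup>2 / N powr (2 * \<alpha>))"
proof -
  define y where "y j = ln (n j / N)" for j
  define X where "X j = real (chi J n (n j) (\<eta> * N))" for j
  \<comment> \<open>Adding 1 gives real parts at least 1, and subtracting i T0 brings the ordinates
    into [0, T]. The factor in \<open>b\<close> undoes both; its modulus exp (y j) is at most 2,
    which costs a factor 4 after squaring.\<close>
  define z where "z s = s + 1 - \<i> * complex_of_real T0" for s
  define b where "b j = a j * exp (complex_of_real (y j) * (1 - \<i> * complex_of_real T0))" for j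
  \<comment> \<open>Since 1 \<le> 1 / \<eta>, this choice gives |z s| \<le> 1 / \<eta> + 1 + T \<le>
    2 lam.\<close>
  define lam where "lam = T + 1 / \<eta>"
  define B where "B = 7168 * lam * (1 + 1 / \<delta>)"
  have X: "X j > 0" if "j \<in> {1..J}" for j using chi_pos[OF that] N \<eta> by (simp add: X_def)
  have lam: "lam > 0" "1 / \<eta> \<le> lam" using T \<eta> by (auto simp: lam_def add_pos_pos)
  have B: "B \<ge> 0" using lam \<delta> by (simp add: B_def)
  have y: "0 \<le> y j" "y j \<le> ln 2" if "j \<in> {1..J}" for j
  proof -
    have "1 \<le> n j / N" "n j / N \<le> 2" using n[OF that] N by (auto simp: field_simps)
    then show "0 \<le> y j" "y j \<le> ln 2" by (auto simp: y_def)
  qed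
  have ln2: "ln 2 \<le> (1::real)" using ln_le_minus_one[of 2] by simp
  have Re_nonneg: "Re s \<ge> 0" if "s \<in> R" for s using adm that \<alpha> by (force simp: admissible_def)
  have z_le: "cmod (z s) \<le> 2 * lam" if s: "s \<in> R" for s
  proof -
    have "cmod (z s) \<le> \<bar>Re (z s)\<bar> + \<bar>Im (z s)\<bar>" by (rule cmod_le)
    also have "\<bar>Re (z s)\<bar> \<le> 1 / \<eta> + 1" using Re_nonneg[OF s] near[OF s] by (simp add: z_def)
    also have "T0 + \<delta> / 2 \<le> Im s \<and> Im s \<le> T0 + T - \<delta> / 2"
      using adm s by (auto simp: admissible_def)
    then have "\<bar>Im (z s)\<bar> \<le> T" using \<delta> by (auto simp: z_def abs_le_iff)
    also have "1 / \<eta> + 1 + T \<le> 2 * lam"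
    proof -
      have "1 \<le> 1 / \<eta>" using \<eta> by simp
      then have "1 / \<eta> + 1 + T \<le> 1 / \<eta> + 1 / \<eta> + 2 * T" using T by (intro add_mono) auto
      then show ?thesis by (simp add: lam_def)
    qed
    finally show ?thesis by simp
  qed
  have dual: "(\<Sum>j\<in>{1..J}. 1 / X j * (cmod (\<Sum>s\<in>R. c s * exp (- (z s * of_real (y j)))))\<^sup>2)
    \<le> B * (\<Sum>s\<in>R. (cmod (c s))\<^sup>2)" for c
    unfolding B_def
  \<comment> \<open>The length \<eta> / 2 is the one for which \<open>chi_window\<close> holds; the
    upper limit 2 suffices because ln 2 \<le> 1 and \<eta> < 1.\<close>
  proof (rule dual_exp_sum_bound[where L = "\<eta> / 2" and Y = 2])
    fix r s assume "r \<in> R" "s \<in> R" "r \<noteq> s"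
    then show "\<delta> \<le> \<bar>Im (z r) - Im (z s)\<bar>" using adm by (auto simp: z_def admissible_def)
  next
    fix u show "(\<Sum>j | j \<in> {1..J} \<and> y j \<le> u \<and> u \<le> y j + \<eta> / 2. 1 / X j) \<le> 1"
      unfolding X_def y_def using N by (intro chi_window n) auto
  next
    fix j assume "j \<in> {1..J}"
    then show "0 \<le> y j \<and> y j + \<eta> / 2 \<le> 2" using y[of j] ln2 \<eta> by auto
  qed (use R \<delta> Re_nonneg z_le lam \<eta> X in \<open>auto simp: z_def less_imp_le\<close>)
  have poly: "(cmod (dirichlet_poly J n a s))\<^sup>2
    \<le> 1 / N powr (2 * \<alpha>) * (cmod (\<Sum>j = 1..J. b j * exp (- (z s * of_real (y j)))))\<^sup>2"
    if s: "s \<in> R" for s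
  proof -
    have "a j * exp (- (s * complex_of_real (y j))) = b j * exp (- (z s * of_real (y j)))" for j
      by (simp add: b_def z_def mult.assoc exp_add[symmetric]) (simp add: algebra_simps)
    then have "dirichlet_poly J n a s = complex_of_real N powr (- s) *
        (\<Sum>j = 1..J. b j * exp (- (z s * of_real (y j))))"
      using N n by (subst dirichlet_poly_eq[of N]) (auto simp: y_def)
    then have "(cmod (dirichlet_poly J n a s))\<^sup>2 = (cmod (complex_of_real N powr (- s)))\<^sup>2 *
        (cmod (\<Sum>j = 1..J. b j * exp (- (z s * of_real (y j)))))\<^sup>2"
      by (simp add: norm_mult power_mult_distrib)
    also have "\<dots> \<le> 1 / N powr (2 * \<alpha>) * (cmod (\<Sum>j = 1..J. b j * exp (- (z s * of_real (y j)))))\<^sup>2"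
      using adm s by (intro mult_right_mono cmod_powr_minus_squared_le N) (auto simp: admissible_def)
    finally show ?thesis .
  qed
  have b: "(cmod (b j))\<^sup>2 \<le> 4 * (cmod (a j))\<^sup>2" if "j \<in> {1..J}" for j
  proof -
    have "exp (y j) \<le> exp (ln 2)" using y(2)[OF that] by (simp only: exp_le_cancel_iff)
    then have "exp (y j) \<le> 2" by simp
    then have "(exp (y j))\<^sup>2 \<le> 2\<^sup>2" by (intro power_mono) auto
    then have "(cmod (a j))\<^sup>2 * (exp (y j))\<^sup>2 \<le> (cmod (a j))\<^sup>2 * 4" by (intro mult_left_mono) auto
    then show ?thesis by (simp add: b_def norm_mult power_mult_distrib)
  qed
  have "(\<Sum>s\<in>R. (cmod (dirichlet_poly J n a s))\<^sup>2)
    \<le> 1 / N powr (2 * \<alpha>) * (\<Sum>s\<in>R. (cmod (\<Sum>j = 1..J. b j * exp (- (z s * of_real (y j)))))\<^sup>2)"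
    unfolding sum_distrib_left by (rule sum_mono) (rule poly)
  also have "\<dots> \<le> 1 / N powr (2 * \<alpha>) * (B * (\<Sum>j = 1..J. (cmod (b j))\<^sup>2 / (1 / X j)))"
    using X by (intro mult_left_mono dual_large_sieve B dual) auto
  also have "\<dots> \<le> 1 / N powr (2 * \<alpha>) * (B * (\<Sum>j = 1..J. 4 * (X j * (cmod (a j))\<^sup>2)))"
  proof (intro mult_left_mono sum_mono B)
    fix j assume j: "j \<in> {1..J}"
    have "(cmod (b j))\<^sup>2 * X j \<le> 4 * (cmod (a j))\<^sup>2 * X j"
      using X[OF j] by (intro mult_right_mono b j) auto
    then show "(cmod (b j))\<^sup>2 / (1 / X j) \<le> 4 * (X j * (cmod (a j))\<^sup>2)" by (simp add: mult_ac)
  qed auto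
  also have "\<dots> = 4 * B * (\<Sum>j = 1..J. X j * (cmod (a j))\<^sup>2 / N powr (2 * \<alpha>))"
    by (simp add: sum_distrib_left[symmetric] sum_divide_distrib[symmetric])
  also have "4 * B = 28672 * ((T + 1 / \<eta>) * (1 + 1 / \<delta>))" by (simp add: B_def lam_def)
  finally show ?thesis by (simp add: X_def)
qed

lemma admissible_subset: "admissible \<alpha> \<delta> T0 T SS \<Longrightarrow> R \<subseteq> SS \<Longrightarrow> admissible \<alpha> \<delta> T0 T R"
  unfolding admissible_def by blast

text \<open>The near points give 2 * 28672 = 57344, as 1 \<le> 2 ln N, and the far points give 2
  through their number; the constant is the sum.\<close>

lemma sum_dirichlet_poly_squared_le:
  fixes N :: real
  assumes \<alpha>: "\<alpha> > 0" and \<delta>: "\<delta> > 0" and T: "T > 0" and adm: "admissible \<alpha> \<delta> T0 T SS" and N: "N \<ge> 2"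
    and n: "\<And>j. j \<in> {1..J} \<Longrightarrow> N \<le> n j \<and> n j \<le> 2 * N" and \<eta>: "\<eta> > 0"
  shows "(\<Sum>s\<in>SS. (cmod (dirichlet_poly J n a s))\<^sup>2) \<le> 57346 * ((T + 1 / \<eta>) * (ln N + 1 / \<delta>) *
    (\<Sum>j = 1..J. real (chi J n (n j) (\<eta> * N)) * (cmod (a j))\<^sup>2 / N powr (2 * \<alpha>)))"
proof -
  define E where "E = (\<Sum>j = 1..J. real (chi J n (n j) (\<eta> * N)) * (cmod (a j))\<^sup>2 / N powr (2 * \<alpha>))"
  define lam where "lam = T + 1 / \<eta>"
  have E: "E \<ge> 0" unfolding E_def by (intro sum_nonneg) auto
  have lam: "lam \<ge> 0" "T \<le> lam" using T \<eta> by (auto simp: lam_def)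
  have "ln 2 \<le> ln N" using N by simp
  moreover have "ln 2 \<ge> (1/2 :: real)" using ln_le_minus_one[of "1/2 :: real"] by (simp add: ln_div)
  ultimately have lnN: "ln N \<ge> 1 / 2" by linarith
  show ?thesis
  proof (cases "finite SS")
    \<comment> \<open>A sum over an infinite set is 0 by convention, so nonnegativity of the
      right-hand side suffices.\<close>
    case False
    moreover have "lam * (ln N + 1 / \<delta>) * E \<ge> 0"
      using lam lnN \<delta> E by (intro mult_nonneg_nonneg) auto
    ultimately show ?thesis by (simp add: E_def lam_def)
  next
    case fin: True
    \<comment> \<open>For \<eta> \<ge> 1 this set is empty and every point is handled
      individually.\<close>
    define R where "R = {s\<in>SS. \<eta> < 1 \<and> Re s \<le> 1 / \<eta>}"
    have R: "R \<subseteq> SS" "finite R" using fin by (auto simp: R_def)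
    have near: "(\<Sum>s\<in>R. (cmod (dirichlet_poly J n a s))\<^sup>2) \<le> 57344 * (lam * (ln N + 1 / \<delta>) * E)"
    proof (cases "\<eta> < 1")
      case True
      have "(\<Sum>s\<in>R. (cmod (dirichlet_poly J n a s))\<^sup>2) \<le> 28672 * (lam * (1 + 1 / \<delta>)) * E"
        unfolding E_def lam_def
        by (rule sum_dirichlet_poly_squared_le_near[OF admissible_subset[OF adm R(1)] R(2) \<delta> T])
           (use \<alpha> N n \<eta> True in \<open>auto simp: R_def\<close>)
      also have "\<dots> \<le> 28672 * (lam * (2 * (ln N + 1 / \<delta>))) * E"
      proof (intro mult_right_mono mult_left_mono)
        have "1 + 1 / \<delta> \<le> 2 * ln N + 2 * (1 / \<delta>)" using lnN \<delta> by (intro add_mono) (auto simp: divide_right_mono)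
        then show "1 + 1 / \<delta> \<le> 2 * (ln N + 1 / \<delta>)" by (simp add: distrib_left)
      qed (use lam E in auto)
      finally show ?thesis by (simp add: mult_ac)
    next
      case False
      then show ?thesis using lam lnN \<delta> E by (simp add: R_def)
    qed
    have "(\<Sum>s\<in>SS - R. (cmod (dirichlet_poly J n a s))\<^sup>2) \<le> (\<Sum>s\<in>SS - R. 2 * E)"
    proof (rule sum_mono)
      fix s assume "s \<in> SS - R"
      then have "Re s \<ge> \<alpha>" "\<eta> \<ge> 1 \<or> Re s \<ge> 1 / \<eta>" using adm by (auto simp: R_def admissible_def)
      then show "(cmod (dirichlet_poly J n a s))\<^sup>2 \<le> 2 * E"
        unfolding E_def using \<alpha> N n \<eta> by (intro dirichlet_poly_squared_le) auto
    qed
    also have "\<dots> = real (card (SS - R)) * (2 * E)" by simp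
    also have "\<dots> \<le> (lam * (ln N + 1 / \<delta>)) * (2 * E)"
    proof (rule mult_right_mono)
      have "real (card (SS - R)) \<le> T / \<delta>"
        using fin by (intro admissible_card_le[OF admissible_subset[OF adm]] \<delta> T) auto
      also have "\<dots> = T * (1 / \<delta>)" by simp
      also have "\<dots> \<le> lam * (ln N + 1 / \<delta>)" using lam lnN \<delta> T by (intro mult_mono) auto
      finally show "real (card (SS - R)) \<le> lam * (ln N + 1 / \<delta>)" .
    qed (use E in auto)
    finally have far: "(\<Sum>s\<in>SS - R. (cmod (dirichlet_poly J n a s))\<^sup>2) \<le> 2 * (lam * (ln N + 1 / \<delta>) * E)"
      by (simp only: mult_ac)
    have "(\<Sum>s\<in>SS. (cmod (dirichlet_poly J n a s))\<^sup>2) =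
      (\<Sum>s\<in>SS - R. (cmod (dirichlet_poly J n a s))\<^sup>2) + (\<Sum>s\<in>R. (cmod (dirichlet_poly J n a s))\<^sup>2)"
      by (rule sum.subset_diff[OF R(1) fin])
    moreover have "c \<le> 57346 * M" if "c = b + a" "a \<le> 57344 * M" "b \<le> 2 * M" for a b c M :: real
      using that by linarith
    ultimately have "(\<Sum>s\<in>SS. (cmod (dirichlet_poly J n a s))\<^sup>2) \<le> 57346 * (lam * (ln N + 1 / \<delta>) * E)"
      using near far by blast
    then show ?thesis by (simp only: E_def lam_def)
  qed
qed

theorem theorem2p3:
  shows "\<exists>C::real. C > 0 \<and>
    (\<forall>(\<alpha>::real) (\<delta>::real) (T0::real) (T::real) (SS::complex set) (N::real) (J::nat)
       (n::nat \<Rightarrow> real) (a::nat \<Rightarrow> complex) (\<eta>::real).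
      \<alpha> > 0 \<longrightarrow> \<delta> > 0 \<longrightarrow> T > 0 \<longrightarrow> admissible \<alpha> \<delta> T0 T SS \<longrightarrow>
      N \<ge> 2 \<longrightarrow> (\<forall>j\<in>{1..J}. N \<le> n j \<and> n j \<le> 2 * N) \<longrightarrow> mono_on {1..J} n \<longrightarrow> \<eta> > 0 \<longrightarrow>
      (\<Sum>s\<in>SS. (cmod (dirichlet_poly J n a s))\<^sup>2)
        \<le> C * ((T + 1 / \<eta>) * (ln N + 1 / \<delta>) *
               (\<Sum>j = 1..J. real (chi J n (n j) (\<eta> * N)) * (cmod (a j))\<^sup>2 / N powr (2 * \<alpha>))))"
proof (intro exI[of _ 57346] conjI allI impI)
  fix \<alpha> \<delta> T0 T \<eta> N :: real and SS :: "complex set" and J :: nat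
    and n :: "nat \<Rightarrow> real" and a :: "nat \<Rightarrow> complex"
  assume asm: "\<alpha> > 0" "\<delta> > 0" "T > 0" "admissible \<alpha> \<delta> T0 T SS" "N \<ge> 2"
    and n: "\<forall>j\<in>{1..J}. N \<le> n j \<and> n j \<le> 2 * N" and \<eta>: "\<eta> > 0"
  show "(\<Sum>s\<in>SS. (cmod (dirichlet_poly J n a s))\<^sup>2)
    \<le> 57346 * ((T + 1 / \<eta>) * (ln N + 1 / \<delta>) *
      (\<Sum>j = 1..J. real (chi J n (n j) (\<eta> * N)) * (cmod (a j))\<^sup>2 / N powr (2 * \<alpha>)))"
    by (rule sum_dirichlet_poly_squared_le[OF asm bspec[OF n] \<eta>])
qed simp

end
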